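(* For every integer $n\ge 1$ there exists a $C^\infty$ function $\gamma:S^n\to\mathbb{R}_{>0}$ with the following properties: $\gamma$ is not a convex integrand, and there exist closed embedded CAMC hypersurfaces in $\mathbb{R}^{n+1}$ for $\gamma$ none of which is a homothety or a translation of the Wulff shape $W_\gamma$. Here a closed embedded CAMC hypersurface for $\gamma$ is the image $X(M)$ of an injective piecewise-$C^2$ weak immersion $X:M\to\mathbb{R}^{n+1}$ of an $n$-dimensional oriented compact connected $C^\infty$ manifold $M$ without boundary which is CAMC for $\gamma$. "Not a homothety or translation of $W_\gamma$" means $X(M)\neq aW_\gamma+b$ for all $a>0$, $b\in\mathbb{R}^{n+1}$.
   Context: $S^n=\{\nu\in\mathbb{R}^{n+1}:\|\nu\|=1\}$. For a positive continuous $\gamma:S^n\to\mathbb{R}_{>0}$, its homogeneous extension is $\overline{\gamma}(rX)=r\gamma(X)$ for $X\in S^n$, $r\ge 0$; $\gamma$ is called a convex integrand if $\overline{\gamma}$ is a convex function on $\mathbb{R}^{n+1}$ (equivalently, $\{\gamma(\nu)^{-1}\nu:\nu\in S^n\}$ bounds a convex set). The Wulff shape $W_\gamma$ is the boundary of the convex set $\bigcap_{\nu\in S^n}\{X\in\mathbb{R}^{n+1}:\langle X,\nu\rangle\le\gamma(\nu)\}$. For $C^2$ $\gamma$, the Cahn–Hoffman map is $\xi_\gamma:S^n\to\mathbb{R}^{n+1}$, $\xi_\gamma(\nu)=D\gamma|_\nu+\gamma(\nu)\nu$ ($D\gamma$ the gradient on $S^n$, $T_\nu S^n$ identified with a hyperplane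 of $\mathbb{R}^{n+1}$); equivalently $\xi_\gamma(\nu)$ is the Euclidean gradient of $\overline\gamma$ at $\nu$. Piecewise-$C^r$ weak immersion: $M=\bigcup_{i=1}^k M_i$ is an $n$-dimensional oriented compact connected $C^\infty$ manifold, each $M_i$ a connected compact $n$-dimensional submanifold with boundary, $M_i\cap M_j=\partial M_i\cap\partial M_j$ for $i\ne j$; $X:M\to\mathbb{R}^{n+1}$ is continuous, each $X|_{M_i}$ is $C^r$, $X|_{M_i^\circ}$ is a $C^r$ immersion, and the unit normal $\nu_i$ of $X|_{M_i^\circ}$ (oriented so that $\{\nu_i,\partial_{u^1},\dots,\partial_{u^n}\}$ is positively oriented for oriented local coordinates) extends to a $C^{r-1}$ map $\nu_i:M_i\to S^n$. $S(X)$ denotes the set of points where $X$ is not an immersion. Cahn–Hoffman field: $\tilde\xi_i=\xi_\gamma\circ\nu_i:M_i\to\mathbb{R}^{n+1}$. At a regular point, the anisotropic shape operator is $S^\gamma=-d\tilde\xi_i$ (viewed as an endomorphism of the tangent space via $dX$), and the anisotropic mean curvature is $\Lambda=\frac1n\operatorname{trace}S^\gamma$. $X$ is called CAMC (constant anisotropic mean curvature) for $\gamma$ if (i) $\Lambda$ is constant on $M\setminus S(X)$, and (ii) $\tilde\xi_i(\zeta)-\tilde\xi_j(\zeta)\in T_\zeta(\partial M_i\cap\partial M_j)$ for every $\zeta\in\partial M_i\cap\partial M_j$ (tangent spaces identified with linear subspaces of $\mathbb{R}^{n+1}$). These are exactly the critical points of $\int_M\gamma(\nu)\,dA$ under volume-preserving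 variations. *)

theory Defs
  imports "HOL-Analysis.Analysis"
begin

definition dpart :: "'a::real_normed_vector \<Rightarrow> ('a \<Rightarrow> 'b::real_normed_vector) \<Rightarrow> 'a \<Rightarrow> 'b" where
  "dpart v f x = vector_derivative (\<lambda>t::real. f (x + t *\<^sub>R v)) (at 0)"

fun iter_pd :: "'a::real_normed_vector list \<Rightarrow> ('a \<Rightarrow> 'b::real_normed_vector) \<Rightarrow> 'a \<Rightarrow> 'b" where
  "iter_pd [] f = f"
| "iter_pd (v # vs) f = dpart v (iter_pd vs f)"

definition Ck :: "nat \<Rightarrow> 'a::euclidean_space set \<Rightarrow> ('a \<Rightarrow> 'b::real_normed_vector) \<Rightarrow> bool" where
  "Ck k U f \<longleftrightarrow> (\<forall>vs. set vs \<subseteq> Basis \<and> length vs \<le> k \<longrightarrow>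
      continuous_on U (iter_pd vs f) \<and>
      (length vs < k \<longrightarrow> (\<forall>v\<in>Basis. \<forall>x\<in>U. (\<lambda>t::real. iter_pd vs f (x + t *\<^sub>R v)) differentiable (at 0))))"

definition Cinf :: "'a::euclidean_space set \<Rightarrow> ('a \<Rightarrow> 'b::real_normed_vector) \<Rightarrow> bool" where
  "Cinf U f \<longleftrightarrow> (\<forall>k. Ck k U f)"

definition Ck_on_set :: "nat \<Rightarrow> 'a::euclidean_space set \<Rightarrow> ('a \<Rightarrow> 'b::real_normed_vector) \<Rightarrow> bool" where
  "Ck_on_set k S f \<longleftrightarrow> (\<forall>x\<in>S. \<exists>V g. open V \<and> x \<in> V \<and> Ck k V g \<and> (\<forall>y\<in>S \<inter> V. g y = f y))"

definition hom_ext :: "('a::real_normed_vector \<Rightarrow> real) \<Rightarrow> 'a \<Rightarrow> real" where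
  "hom_ext \<gamma> x = norm x * \<gamma> (x /\<^sub>R norm x)"

definition smooth_on_sphere :: "('a::euclidean_space \<Rightarrow> real) \<Rightarrow> bool" where
  "smooth_on_sphere \<gamma> \<longleftrightarrow> Cinf (- {0}) (\<lambda>x. \<gamma> (x /\<^sub>R norm x))"

definition convex_integrand :: "('a::euclidean_space \<Rightarrow> real) \<Rightarrow> bool" where
  "convex_integrand \<gamma> \<longleftrightarrow> convex_on UNIV (hom_ext \<gamma>)"

definition wulff_shape :: "('a::euclidean_space \<Rightarrow> real) \<Rightarrow> 'a set" where
  "wulff_shape \<gamma> = frontier (\<Inter>\<nu>\<in>sphere 0 1. {x. x \<bullet> \<nu> \<le> \<gamma> \<nu>})"

definition cahn_hoffman :: "(real^'e \<Rightarrow> real) \<Rightarrow> real^'e \<Rightarrow> real^'e" where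
  "cahn_hoffman \<gamma> \<nu> = (\<chi> r. dpart (axis r 1) (hom_ext \<gamma>) \<nu>)"

definition is_chart :: "'m topology \<Rightarrow> 'm set \<Rightarrow> ('m \<Rightarrow> real^'n) \<Rightarrow> bool" where
  "is_chart T U \<phi> \<longleftrightarrow> openin T U \<and> open (\<phi> ` U) \<and>
     homeomorphic_map (subtopology T U) (top_of_set (\<phi> ` U)) \<phi>"

definition smooth_compat :: "'m set \<Rightarrow> ('m \<Rightarrow> real^'n) \<Rightarrow> 'm set \<Rightarrow> ('m \<Rightarrow> real^'n) \<Rightarrow> bool" where
  "smooth_compat U \<phi> V \<psi> \<longleftrightarrow>
     Cinf (\<phi> ` (U \<inter> V)) (\<psi> \<circ> inv_into U \<phi>) \<and> Cinf (\<psi> ` (U \<inter> V)) (\<phi> \<circ> inv_into V \<psi>)"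

definition jacobian_det :: "(real^'n \<Rightarrow> real^'n) \<Rightarrow> real^'n \<Rightarrow> real" where
  "jacobian_det f x = det (\<chi> a b. dpart (axis b 1) f x $ a)"

definition closed_oriented_manifold :: "'m topology \<Rightarrow> ('m set \<times> ('m \<Rightarrow> real^'n)) set \<Rightarrow> bool" where
  "closed_oriented_manifold T A \<longleftrightarrow>
     topspace T \<noteq> {} \<and> Hausdorff_space T \<and> compact_space T \<and> connected_space T \<and>
     (\<forall>(U,\<phi>)\<in>A. is_chart T U \<phi>) \<and> \<Union>(fst ` A) = topspace T \<and>
     (\<forall>(U,\<phi>)\<in>A. \<forall>(V,\<psi>)\<in>A. smooth_compat U \<phi> V \<psi> \<and>
        (\<forall>x\<in>\<phi> ` (U \<inter> V). jacobian_det (\<psi> \<circ> inv_into U \<phi>) x > 0))"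

definition compatible_chart :: "'m topology \<Rightarrow> ('m set \<times> ('m \<Rightarrow> real^'n)) set \<Rightarrow> 'm set \<Rightarrow> ('m \<Rightarrow> real^'n) \<Rightarrow> bool" where
  "compatible_chart T A W \<theta> \<longleftrightarrow> is_chart T W \<theta> \<and> (\<forall>(U,\<phi>)\<in>A. smooth_compat U \<phi> W \<theta>)"

definition regular_domain :: "'m topology \<Rightarrow> ('m set \<times> ('m \<Rightarrow> real^'n)) set \<Rightarrow> 'm set \<Rightarrow> bool" where
  "regular_domain T A D \<longleftrightarrow> closedin T D \<and>
     (\<forall>p\<in>D. \<exists>W \<theta>. compatible_chart T A W \<theta> \<and> p \<in> W \<and>
        (\<theta> ` (W \<inter> D) = \<theta> ` W \<or>
         (\<exists>k. \<theta> p $ k = 0 \<and> \<theta> ` (W \<inter> D) = \<theta> ` W \<inter> {x. x $ k \<le> 0})))"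

definition mbdry :: "'m topology \<Rightarrow> 'm set \<Rightarrow> 'm set" where
  "mbdry T D = D - T interior_of D"

section \<open>Piecewise-C^r weak immersions into R^(n+1) = real^('n option)\<close>

definition pos_normal_at :: "('n::finite) itself \<Rightarrow> (real^'n \<Rightarrow> real^'n option) \<Rightarrow> real^'n \<Rightarrow> real^'n option \<Rightarrow> bool" where
  "pos_normal_at _ Y x \<nu> \<longleftrightarrow>
     (\<forall>c::'n \<Rightarrow> real. (\<Sum>j\<in>UNIV. c j *\<^sub>R dpart (axis j 1) Y x) = 0 \<longrightarrow> (\<forall>j. c j = 0)) \<and>
     norm \<nu> = 1 \<and> (\<forall>j. \<nu> \<bullet> dpart (axis j 1) Y x = 0) \<and>
     det (\<chi> a b. (case b of None \<Rightarrow> \<nu> | Some j \<Rightarrow> dpart (axis j 1) Y x) $ a) > 0"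

definition piecewise_weak_immersion ::
  "nat \<Rightarrow> 'm topology \<Rightarrow> ('m set \<times> ('m \<Rightarrow> real^'n::finite)) set \<Rightarrow> nat \<Rightarrow> (nat \<Rightarrow> 'm set)
     \<Rightarrow> (nat \<Rightarrow> 'm \<Rightarrow> real^'n option) \<Rightarrow> ('m \<Rightarrow> real^'n option) \<Rightarrow> bool" where
  "piecewise_weak_immersion r T A k P N X \<longleftrightarrow>
     closed_oriented_manifold T A \<and> k \<ge> 1 \<and>
     (\<Union>i<k. P i) = topspace T \<and>
     (\<forall>i<k. regular_domain T A (P i) \<and> compactin T (P i) \<and> connectedin T (P i)) \<and>
     (\<forall>i<k. \<forall>j<k. i \<noteq> j \<longrightarrow> P i \<inter> P j = mbdry T (P i) \<inter> mbdry T (P j)) \<and>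
     continuous_map T euclidean X \<and>
     (\<forall>i<k. \<forall>(U,\<phi>)\<in>A.
        Ck_on_set r (\<phi> ` (U \<inter> P i)) (X \<circ> inv_into U \<phi>) \<and>
        Ck_on_set (r - 1) (\<phi> ` (U \<inter> P i)) (N i \<circ> inv_into U \<phi>)) \<and>
     (\<forall>i<k. \<forall>p\<in>P i. norm (N i p) = 1) \<and>
     (\<forall>i<k. \<forall>p\<in>T interior_of (P i). \<forall>(U,\<phi>)\<in>A. p \<in> U \<longrightarrow>
        pos_normal_at TYPE('n) (X \<circ> inv_into U \<phi>) (\<phi> p) (N i p))"

text \<open>(1/n) trace of the anisotropic shape operator, in a chart: Y the local parametrization,
  Nc the unit normal in chart coordinates.\<close>
definition aniso_mc :: "(real^'n option \<Rightarrow> real) \<Rightarrow> (real^'n::finite \<Rightarrow> real^'n option)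
     \<Rightarrow> (real^'n \<Rightarrow> real^'n option) \<Rightarrow> real^'n \<Rightarrow> real" where
  "aniso_mc \<gamma> Y Nc x =
     (let G = (\<chi> j l. dpart (axis j 1) Y x \<bullet> dpart (axis l 1) Y x) :: real^'n^'n;
          B = (\<chi> j l. - (dpart (axis j 1) (\<lambda>y. cahn_hoffman \<gamma> (Nc y)) x) \<bullet> dpart (axis l 1) Y x)
                 :: real^'n^'n
      in (1 / real CARD('n)) * trace (B ** matrix_inv G))"

definition tangent_vecs :: "'m topology \<Rightarrow> ('m set \<times> ('m \<Rightarrow> real^'n)) set \<Rightarrow> ('m \<Rightarrow> real^'e)
     \<Rightarrow> 'm set \<Rightarrow> 'm \<Rightarrow> (real^'e) set" where
  "tangent_vecs T A X D \<zeta> = {v. \<exists>c \<epsilon> U \<phi>. (U,\<phi>) \<in> A \<and> \<epsilon> > 0 \<and> c 0 = \<zeta> \<and>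
       (\<forall>t\<in>{-\<epsilon><..<\<epsilon>}. c t \<in> D \<inter> U) \<and> Ck 1 {-\<epsilon><..<\<epsilon>} (\<phi> \<circ> c) \<and>
       ((X \<circ> c) has_vector_derivative v) (at 0)}"

definition CAMC :: "(real^'n option \<Rightarrow> real) \<Rightarrow> 'm topology \<Rightarrow> ('m set \<times> ('m \<Rightarrow> real^'n::finite)) set
     \<Rightarrow> nat \<Rightarrow> (nat \<Rightarrow> 'm set) \<Rightarrow> (nat \<Rightarrow> 'm \<Rightarrow> real^'n option) \<Rightarrow> ('m \<Rightarrow> real^'n option) \<Rightarrow> bool" where
  "CAMC \<gamma> T A k P N X \<longleftrightarrow>
     (\<exists>\<Lambda>. \<forall>i<k. \<forall>p\<in>T interior_of (P i). \<forall>(U,\<phi>)\<in>A. p \<in> U \<longrightarrow>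
         aniso_mc \<gamma> (X \<circ> inv_into U \<phi>) (N i \<circ> inv_into U \<phi>) (\<phi> p) = \<Lambda>) \<and>
     (\<forall>i<k. \<forall>j<k. i \<noteq> j \<longrightarrow> (\<forall>\<zeta>\<in>P i \<inter> P j.
         cahn_hoffman \<gamma> (N i \<zeta>) - cahn_hoffman \<gamma> (N j \<zeta>) \<in> span (tangent_vecs T A X (P i \<inter> P j) \<zeta>)))"

definition closed_embedded_CAMC :: "(real^'n option \<Rightarrow> real) \<Rightarrow> 'm topology \<Rightarrow> ('m set \<times> ('m \<Rightarrow> real^'n::finite)) set
     \<Rightarrow> nat \<Rightarrow> (nat \<Rightarrow> 'm set) \<Rightarrow> (nat \<Rightarrow> 'm \<Rightarrow> real^'n option) \<Rightarrow> ('m \<Rightarrow> real^'n option) \<Rightarrow> bool" where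
  "closed_embedded_CAMC \<gamma> T A k P N X \<longleftrightarrow>
     piecewise_weak_immersion 2 T A k P N X \<and> inj_on X (topspace T) \<and> CAMC \<gamma> T A k P N X"

end

theory Submission
  imports Defs
begin

text \<open>Cut the unit ball centred at \<open>-(3/5) e\<close> and the one centred at \<open>(3/5) e\<close>, where \<open>e = axis None 1\<close>, and let
  the lens be their intersection. The upper half of its boundary has normals \<open>\<nu>\<close> with \<open>\<nu> $ None \<ge> 3/5\<close>. If
  \<open>\<gamma> \<nu> = 1 - 3/5 * \<bar>\<nu> $ None\<bar>\<close> for \<open>\<bar>\<nu> $ None\<bar> \<ge> 1/2\<close>, then \<open>\<gamma>\<close> restricted to these normals is the support
  function of the lens, so the Cahn--Hoffman map sends the normal at a point of either half back to that point:
  the anisotropic mean curvature is \<open>-1\<close> and the two Cahn--Hoffman fields agree on the edge. Between the two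
  caps of normals \<open>\<gamma>\<close> is free. Letting it drop to \<open>2/5\<close> at the equator, far below the support function of
  the lens, makes \<open>\<gamma>\<close> non-convex and its Wulff shape too narrow to be homothetic to the lens.\<close>

subsection \<open>Calculus of smooth functions\<close>

text \<open>The unit ball about \<open>c\<close> has support function
  \<open>1 + c \<bullet> \<nu>\<close>; this is the origin of the formula for
  \<open>\<gamma>\<close>, and the gradient of its homogeneous extension at a unit vector
  \<open>\<nu>\<close> is the boundary point \<open>\<nu> + c\<close>. Normals jump across the edge
  of the lens, so heights strictly between -3/5 and 3/5 never occur. The threshold 1/2 lies below
  3/5 because the Cahn--Hoffman map differentiates \<open>\<gamma>\<close>: the formula has to hold
  on a neighbourhood of the edge normals too. The offset 3/5 keeps everything rational: the edge has
  radius 4/5 and the tips have height 2/5. The labour lies in checking immersion, orientation and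
  curvature in every chart of an atlas, with regularity up to the edge. The lens is therefore
  parametrised over the unit sphere, one hemisphere for each half, by maps that are conformal up to
  translation. In stereographic coordinates such a map is the inverse projection after a dilation,
  followed by a translation, so each local check reduces to one about
  \<open>stereo_inv\<close>.\<close>

text \<open>A recursive variant of \<open>Ck\<close> with Frechet derivatives, which unlike \<open>Ck\<close> is visibly closed under
  composition.\<close>

primrec Dk :: "nat \<Rightarrow> 'a::euclidean_space set \<Rightarrow> ('a \<Rightarrow> 'b::real_normed_vector) \<Rightarrow> bool" where
  "Dk 0 U f \<longleftrightarrow> continuous_on U f"
| "Dk (Suc k) U f \<longleftrightarrow> (\<exists>f'. (\<forall>x\<in>U. (f has_derivative f' x) (at x)) \<and> (\<forall>v\<in>Basis. Dk k U (\<lambda>x. f' x v)))"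

lemma Dk_continuous: "Dk k U f \<Longrightarrow> continuous_on U f"
  by (cases k) (auto intro!: continuous_at_imp_continuous_on dest: has_derivative_continuous)

lemma Dk_Suc_D: "Dk (Suc k) U f \<Longrightarrow> Dk k U f"
proof (induction k arbitrary: f)
  case 0
  then show ?case using Dk_continuous by (metis Dk.simps(1))
next
  case (Suc k)
  then obtain f' where "\<forall>x\<in>U. (f has_derivative f' x) (at x)" "\<forall>v\<in>Basis. Dk (Suc k) U (\<lambda>x. f' x v)"
    by (metis Dk.simps(2))
  then show ?case using Suc.IH by (metis Dk.simps(2))
qed

lemma Dk_cong:
  assumes "open U" "\<And>x. x \<in> U \<Longrightarrow> f x = g x" "Dk k U f"
  shows "Dk k U g"
proof (cases k)
  case 0
  then show ?thesis using assms continuous_on_cong[of U U f g] by auto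
next
  case (Suc m)
  then obtain f' where f': "\<forall>x\<in>U. (f has_derivative f' x) (at x)" "\<forall>v\<in>Basis. Dk m U (\<lambda>x. f' x v)"
    using assms by auto
  have "(g has_derivative f' x) (at x)" if "x \<in> U" for x
    using has_derivative_transform_within_open[of f "f' x" x UNIV U g] f' that assms by auto
  with f' Suc show ?thesis by auto
qed

lemma Dk_subset: "Dk k U f \<Longrightarrow> V \<subseteq> U \<Longrightarrow> Dk k V f"
proof (induction k arbitrary: f)
  case 0
  then show ?case by (auto intro: continuous_on_subset)
next
  case (Suc k)
  then obtain f' where "\<forall>x\<in>U. (f has_derivative f' x) (at x)" "\<forall>v\<in>Basis. Dk k U (\<lambda>x. f' x v)"
    by auto
  with Suc have "(\<forall>x\<in>V. (f has_derivative f' x) (at x)) \<and> (\<forall>v\<in>Basis. Dk k V (\<lambda>x. f' x v))"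
    by blast
  then show ?case by auto
qed

lemma Dk_const: "Dk k U (\<lambda>x. c)"
proof (induction k arbitrary: c)
  case (Suc k)
  show ?case unfolding Dk.simps by (intro exI[of _ "\<lambda>x h. 0"]) (simp add: Suc.IH)
qed auto

lemma Dk_linear: "bounded_linear f \<Longrightarrow> Dk k U f"
proof (induction k)
  case (Suc k)
  then show ?case unfolding Dk.simps
    by (intro exI[of _ "\<lambda>x. f"]) (auto simp: Dk_const bounded_linear_imp_has_derivative)
qed (auto intro: linear_continuous_on)

lemma Dk_linear_comp: "bounded_linear L \<Longrightarrow> Dk k U f \<Longrightarrow> Dk k U (\<lambda>x. L (f x))"
proof (induction k arbitrary: f)
  case 0
  then show ?case by (auto intro: bounded_linear.continuous_on)
next
  case (Suc k)
  then obtain f' where f': "\<forall>x\<in>U. (f has_derivative f' x) (at x)" "\<forall>v\<in>Basis. Dk k U (\<lambda>x. f' x v)"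
    by auto
  show ?case unfolding Dk.simps
    by (intro exI[of _ "\<lambda>x v. L (f' x v)"])
      (use f' Suc in \<open>auto intro: bounded_linear.has_derivative\<close>)
qed

lemma Dk_add: "Dk k U f \<Longrightarrow> Dk k U g \<Longrightarrow> Dk k U (\<lambda>x. f x + g x)"
proof (induction k arbitrary: f g)
  case 0
  then show ?case by (auto intro: continuous_on_add)
next
  case (Suc k)
  obtain f' where f': "\<forall>x\<in>U. (f has_derivative f' x) (at x)" "\<forall>v\<in>Basis. Dk k U (\<lambda>x. f' x v)"
    using Suc.prems by auto
  obtain g' where g': "\<forall>x\<in>U. (g has_derivative g' x) (at x)" "\<forall>v\<in>Basis. Dk k U (\<lambda>x. g' x v)"
    using Suc.prems by auto
  show ?case unfolding Dk.simps
    by (intro exI[of _ "\<lambda>x v. f' x v + g' x v"]) (use f' g' Suc in \<open>auto intro: has_derivative_add\<close>)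
qed

lemma Dk_uminus: "Dk k U f \<Longrightarrow> Dk k U (\<lambda>x. - f x)"
  by (rule Dk_linear_comp[OF bounded_linear_minus[OF bounded_linear_ident]])

lemma Dk_diff: "Dk k U f \<Longrightarrow> Dk k U g \<Longrightarrow> Dk k U (\<lambda>x. f x - g x)"
  using Dk_add[of k U f "\<lambda>x. - g x"] Dk_uminus by auto

lemma Dk_sum: "finite I \<Longrightarrow> (\<And>i. i \<in> I \<Longrightarrow> Dk k U (f i)) \<Longrightarrow> Dk k U (\<lambda>x. \<Sum>i\<in>I. f i x)"
  by (induction I rule: finite_induct) (auto intro: Dk_add Dk_const)

lemma (in bounded_bilinear) Dk_bilinear:
  "Dk k U f \<Longrightarrow> Dk k U g \<Longrightarrow> Dk k U (\<lambda>x. prod (f x) (g x))"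
proof (induction k arbitrary: f g)
  case 0
  then show ?case by (auto intro: continuous_on)
next
  case (Suc k)
  obtain f' where f': "\<forall>x\<in>U. (f has_derivative f' x) (at x)" "\<forall>v\<in>Basis. Dk k U (\<lambda>x. f' x v)"
    using Suc.prems by auto
  obtain g' where g': "\<forall>x\<in>U. (g has_derivative g' x) (at x)" "\<forall>v\<in>Basis. Dk k U (\<lambda>x. g' x v)"
    using Suc.prems by auto
  show ?case unfolding Dk.simps
    by (intro exI[of _ "\<lambda>x v. prod (f x) (g' x v) + prod (f' x v) (g x)"])
      (use f' g' Suc in \<open>auto intro!: FDERIV Dk_add Suc.IH intro: Dk_Suc_D[of k U f] Dk_Suc_D[of k U g]
        simp del: Dk.simps\<close>)
qed

lemmas Dk_scaleR = bounded_bilinear.Dk_bilinear[OF bounded_bilinear_scaleR]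
lemmas Dk_mult = bounded_bilinear.Dk_bilinear[OF bounded_bilinear_mult]
lemmas Dk_inner = bounded_bilinear.Dk_bilinear[OF bounded_bilinear_inner]

text \<open>\<open>Dk\<close> records derivatives along the fixed basis vectors only, whereas the
  chain rule evaluates the derivative of \<open>f\<close> in the moving direction
  \<open>g' x v\<close>. Expanding this direction in the basis gives a finite sum of products of
  scalar functions with \<open>f' (g x) b\<close>, to which the induction hypothesis and the product
  rule apply.\<close>

lemma Dk_compose:
  fixes f :: "'b::euclidean_space \<Rightarrow> 'c::real_normed_vector" and g :: "'a::euclidean_space \<Rightarrow> 'b"
  shows "Dk k V f \<Longrightarrow> Dk k U g \<Longrightarrow> g ` U \<subseteq> V \<Longrightarrow> Dk k U (\<lambda>x. f (g x))"
proof (induction k arbitrary: f g)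
  case 0
  then show ?case using continuous_on_compose2[of V f U g] by simp
next
  case (Suc k)
  obtain f' where f': "\<forall>x\<in>V. (f has_derivative f' x) (at x)" "\<forall>v\<in>Basis. Dk k V (\<lambda>x. f' x v)"
    using Suc.prems by auto
  obtain g' where g': "\<forall>x\<in>U. (g has_derivative g' x) (at x)" "\<forall>v\<in>Basis. Dk k U (\<lambda>x. g' x v)"
    using Suc.prems by auto
  have gU: "Dk k U g" by (rule Dk_Suc_D[OF Suc.prems(2)])
  have lin: "f' (g x) w = (\<Sum>b\<in>Basis. (w \<bullet> b) *\<^sub>R f' (g x) b)" if "x \<in> U" for x w
  proof -
    have "g x \<in> V" using that Suc.prems(3) by blast
    then have "linear (f' (g x))" using f'(1) has_derivative_linear by blast
    then have "f' (g x) (\<Sum>b\<in>Basis. (w \<bullet> b) *\<^sub>R b) = (\<Sum>b\<in>Basis. (w \<bullet> b) *\<^sub>R f' (g x) b)"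
      by (subst linear_sum) (auto intro!: sum.cong linear_cmul)
    then show ?thesis by (simp add: euclidean_representation)
  qed
  have D: "((\<lambda>x. f (g x)) has_derivative (\<lambda>v. \<Sum>b\<in>Basis. (g' x v \<bullet> b) *\<^sub>R f' (g x) b)) (at x)" if "x \<in> U" for x
  proof -
    have "((\<lambda>x. f (g x)) has_derivative (\<lambda>v. f' (g x) (g' x v))) (at x)"
      using f' g' that Suc.prems(3) by (intro has_derivative_compose[of g "g' x" x UNIV f "f' (g x)"]) blast+
    moreover have "(\<lambda>v. f' (g x) (g' x v)) = (\<lambda>v. \<Sum>b\<in>Basis. (g' x v \<bullet> b) *\<^sub>R f' (g x) b)"
      using lin[OF that] by (intro ext)
    ultimately show ?thesis by (rule back_subst)
  qed
  have fg: "Dk k U (\<lambda>x. f' (g x) b)" if "b \<in> Basis" for b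
    using Suc.IH[of "\<lambda>y. f' y b" g] f'(2) gU Suc.prems(3) that by simp
  have "Dk k U (\<lambda>x. \<Sum>b\<in>Basis. (g' x v \<bullet> b) *\<^sub>R f' (g x) b)" if "v \<in> Basis" for v
    using that g' by (intro Dk_sum[OF finite_Basis] Dk_scaleR Dk_inner Dk_const fg) blast
  with D show ?case unfolding Dk.simps
    by (intro exI[of _ "\<lambda>x v. \<Sum>b\<in>Basis. (g' x v \<bullet> b) *\<^sub>R f' (g x) b"] conjI ballI)
qed

lemma Dk_real_SucI:
  fixes f :: "real \<Rightarrow> real"
  assumes "\<And>x. x \<in> U \<Longrightarrow> (f has_real_derivative f' x) (at x)" "Dk k U f'"
  shows "Dk (Suc k) U f"
  unfolding Dk.simps
  by (intro exI[of _ "\<lambda>x v. f' x * v"]) (use assms in \<open>auto simp: has_field_derivative_def\<close>)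

lemma Dk_real_inverse: "Dk k (- {0}) (inverse :: real \<Rightarrow> real)"
proof (induction k)
  case 0
  then show ?case by (auto intro: continuous_intros)
next
  case (Suc k)
  show ?case
    by (rule Dk_real_SucI[of _ _ "\<lambda>x. - (inverse x * inverse x)"])
      (auto intro!: Dk_uminus Dk_mult Suc derivative_eq_intros)
qed

lemma Dk_inverse:
  "Dk k U f \<Longrightarrow> (\<And>x. x \<in> U \<Longrightarrow> f x \<noteq> 0) \<Longrightarrow> Dk k U (\<lambda>x. inverse (f x :: real))"
  by (rule Dk_compose[OF Dk_real_inverse]) auto

lemma Dk_divide:
  "Dk k U f \<Longrightarrow> Dk k U g \<Longrightarrow> (\<And>x. x \<in> U \<Longrightarrow> g x \<noteq> 0) \<Longrightarrow> Dk k U (\<lambda>x. f x / (g x :: real))"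
  unfolding divide_inverse by (intro Dk_mult Dk_inverse)

lemma Dk_real_sqrt: "Dk k {0<..} sqrt"
proof (induction k)
  case 0
  then show ?case using continuous_on_real_sqrt[OF continuous_on_id] by simp
next
  case (Suc k)
  show ?case
  proof (rule Dk_real_SucI[of _ _ "\<lambda>x. inverse (sqrt x) / 2"])
    show "Dk k {0<..} (\<lambda>x. inverse (sqrt x) / 2)"
      unfolding divide_inverse[of _ 2] by (rule Dk_mult[OF Dk_inverse[OF Suc] Dk_const]) auto
  qed (simp add: DERIV_real_sqrt)
qed

lemma Dk_sqrt: "Dk k U f \<Longrightarrow> (\<And>x. x \<in> U \<Longrightarrow> f x > 0) \<Longrightarrow> Dk k U (\<lambda>x. sqrt (f x))"
  by (rule Dk_compose[OF Dk_real_sqrt]) auto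

lemma Dk_id: "Dk k U (\<lambda>x. x)"
  by (rule Dk_linear) (rule bounded_linear_ident)

lemma Dk_vec_nth: "Dk k U f \<Longrightarrow> Dk k U (\<lambda>x. (f x :: real^'n) $ i)"
  by (rule Dk_linear_comp[OF bounded_linear_vec_nth])

lemma Dk_vec_lambda:
  fixes f :: "'a::euclidean_space \<Rightarrow> 'n::finite \<Rightarrow> real"
  assumes "\<And>i. Dk k U (\<lambda>x. f x i)"
  shows "Dk k U (\<lambda>x. \<chi> i. f x i)"
proof -
  have "(\<lambda>x. \<chi> i. f x i) = (\<lambda>x. \<Sum>i\<in>UNIV. f x i *\<^sub>R axis i 1)"
    by (auto simp: vec_eq_iff axis_def if_distrib cong: if_cong)
  then show ?thesis
    by (simp add: Dk_sum Dk_scaleR Dk_const assms)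
qed

section \<open>From Frechet derivatives to iterated partial derivatives\<close>

lemma has_derivative_along_line:
  fixes f :: "'a::real_normed_vector \<Rightarrow> 'b::real_normed_vector"
  assumes "(f has_derivative f') (at x)"
  shows "((\<lambda>t. f (x + t *\<^sub>R v)) has_vector_derivative f' v) (at 0)"
proof -
  have 1: "((\<lambda>t::real. x + t *\<^sub>R v) has_derivative (\<lambda>t. t *\<^sub>R v)) (at 0)"
    by (auto intro!: derivative_eq_intros)
  have "((\<lambda>t. f (x + t *\<^sub>R v)) has_derivative (\<lambda>t. f' (t *\<^sub>R v))) (at 0)"
    using has_derivative_compose[OF 1, of f f'] assms by simp
  then show ?thesis
    unfolding has_vector_derivative_def
    using linear_cmul[OF has_derivative_linear[OF assms]] by simp
qed

lemma dpart_eq: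
  fixes f :: "'a::real_normed_vector \<Rightarrow> 'b::real_normed_vector"
  shows "(f has_derivative f') (at x) \<Longrightarrow> dpart v f x = f' v"
  unfolding dpart_def by (intro vector_derivative_at has_derivative_along_line)

text \<open>Every partial derivative costs one order, hence the index \<open>k - length vs\<close>.
  The partial derivative is identified with the Frechet derivative in direction \<open>v\<close> on
  \<open>U\<close> only, which suffices because \<open>U\<close> is open.\<close>

lemma Dk_iter_pd:
  fixes f :: "'a::euclidean_space \<Rightarrow> 'b::real_normed_vector"
  assumes "open U" "Dk k U f"
  shows "set vs \<subseteq> Basis \<Longrightarrow> length vs \<le> k \<Longrightarrow> Dk (k - length vs) U (iter_pd vs f)"
proof (induction vs)
  case Nil
  then show ?case using assms by simp
next
  case (Cons v vs)
  then have "Dk (Suc (k - length (v # vs))) U (iter_pd vs f)"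
    by (simp add: Suc_diff_Suc Suc_le_eq del: Dk.simps)
  then obtain f' where f': "\<forall>x\<in>U. (iter_pd vs f has_derivative f' x) (at x)"
    "\<forall>v\<in>Basis. Dk (k - length (v # vs)) U (\<lambda>x. f' x v)"
    by auto
  show ?case
    by (rule Dk_cong[OF \<open>open U\<close>, of "\<lambda>x. f' x v"]) (use f' dpart_eq[of "iter_pd vs f" "f' x" x v for x] Cons.prems in auto)
qed

lemma Dk_imp_Ck:
  fixes f :: "'a::euclidean_space \<Rightarrow> 'b::real_normed_vector"
  assumes "open U" "Dk k U f"
  shows "Ck k U f"
  unfolding Ck_def
proof (intro allI impI conjI ballI)
  fix vs :: "'a list" assume vs: "set vs \<subseteq> Basis \<and> length vs \<le> k"
  note D = Dk_iter_pd[OF assms]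
  show "continuous_on U (iter_pd vs f)" using D vs Dk_continuous by blast
  fix v x :: 'a assume "length vs < k" "v \<in> Basis" "x \<in> U"
  then have "Dk (Suc (k - Suc (length vs))) U (iter_pd vs f)" using D[of vs] vs
    by (simp add: Suc_diff_Suc del: Dk.simps)
  then obtain f' where "(iter_pd vs f has_derivative f') (at x)" using \<open>x \<in> U\<close> by auto
  from has_derivative_along_line[OF this]
  show "(\<lambda>t. iter_pd vs f (x + t *\<^sub>R v)) differentiable at 0"
    by (metis differentiableI_vector)
qed

lemma Dk_imp_Cinf: "open U \<Longrightarrow> (\<And>k. Dk k U f) \<Longrightarrow> Cinf U f"
  by (simp add: Cinf_def Dk_imp_Ck)

lemma Dk_imp_Ck_on_set:
  assumes "open V" "Dk k V g" "S \<subseteq> V" "\<And>y. y \<in> S \<Longrightarrow> g y = f y"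
  shows "Ck_on_set k S f"
  unfolding Ck_on_set_def using assms Dk_imp_Ck by blast

text \<open>The powers of \<open>inverse t\<close> are carried along because they appear in the derivatives.\<close>

lemma Dk_exp_inverse:
  "Dk k UNIV (\<lambda>t::real. if t > 0 then exp (- inverse t) * inverse t ^ m else 0)"
proof (induction k arbitrary: m)
  have D: "((\<lambda>t::real. if t > 0 then exp (- inverse t) * inverse t ^ m else 0) has_real_derivative
      (if t > 0 then exp (- inverse t) * inverse t ^ (m + 2) else 0) -
      real m * (if t > 0 then exp (- inverse t) * inverse t ^ (m + 1) else 0)) (at t)"
    (is "(?f m has_real_derivative ?f' t) _") for m and t :: real
  proof -
    consider "t > 0" | "t < 0" | "t = 0" by linarith
    then show ?thesis
    proof cases
      case 1
      have "((\<lambda>t. exp (- inverse t) * inverse t ^ m) has_real_derivative ?f' t) (at t)"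
      proof -
        have "((\<lambda>t. exp (- inverse t) * inverse t ^ m) has_real_derivative
          exp (- inverse t) * (inverse t)\<^sup>2 * inverse t ^ m +
          exp (- inverse t) * (real m * inverse t ^ (m - 1) * - ((inverse t)\<^sup>2))) (at t)"
          using 1 by (auto intro!: derivative_eq_intros simp: power2_eq_square)
        also have "exp (- inverse t) * (inverse t)\<^sup>2 * inverse t ^ m +
          exp (- inverse t) * (real m * inverse t ^ (m - 1) * - ((inverse t)\<^sup>2)) = ?f' t"
          using 1 by (cases m) (simp_all add: power2_eq_square algebra_simps)
        finally show ?thesis .
      qed
      then show ?thesis
        by (rule DERIV_cong_ev[THEN iffD1, rotated 3])
          (use 1 eventually_nhds_in_open[of "{0<..}" t] in \<open>auto elim!: eventually_mono\<close>)
    next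
      case 2
      have "((\<lambda>t::real. 0) has_real_derivative ?f' t) (at t)"
        using 2 by (auto intro!: derivative_eq_intros)
      then show ?thesis
        by (rule DERIV_cong_ev[THEN iffD1, rotated 3])
          (use 2 eventually_nhds_in_open[of "{..<0}" t] in \<open>auto elim!: eventually_mono\<close>)
    next
      case 3
      \<comment> \<open>Substituting \<open>u = inverse s\<close> turns the right-hand difference
        quotient at 0 into \<open>u ^ (m+1) / exp u\<close>, which tends to 0 as \<open>u\<close>
        grows; on the left the quotient vanishes identically.\<close>
      have "((\<lambda>s. ?f m s / s) \<longlongrightarrow> 0) (at_right (0::real))"
      proof (rule Lim_transform_eventually)
        have "((\<lambda>x::real. x ^ (m+1) / exp x) \<longlongrightarrow> 0) at_top"
          by (rule tendsto_power_div_exp_0)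
        from filterlim_compose[OF this filterlim_inverse_at_top_right]
        show "((\<lambda>s. inverse s ^ (m+1) / exp (inverse s)) \<longlongrightarrow> 0) (at_right (0::real))" .
        show "\<forall>\<^sub>F s::real in at_right 0. inverse s ^ (m+1) / exp (inverse s) = ?f m s / s"
          using eventually_at_right_less[of 0] by eventually_elim (auto simp: exp_minus field_simps)
      qed
      moreover have "((\<lambda>s. ?f m s / s) \<longlongrightarrow> 0) (at_left (0::real))"
        by (rule tendsto_eventually) (simp add: eventually_at_filter)
      ultimately have "((\<lambda>s. ?f m s / s) \<longlongrightarrow> 0) (at (0::real))"
        by (rule filterlim_split_at[rotated])
      then show ?thesis using 3 by (simp add: has_field_derivative_iff)
    qed
  qed
  {
    case 0
    show ?case unfolding Dk.simps
      by (intro continuous_at_imp_continuous_on ballI DERIV_isCont[OF D])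
  next
    case (Suc k)
    show ?case
      by (rule Dk_real_SucI[OF D]) (intro Dk_diff Dk_mult Dk_const Suc)
  }
qed

text \<open>The upper threshold 1/2 stays below 3/5, the least height among the cap normals. The
  lower threshold 1/4 is positive, so the cutoffs at \<open>t\<close> and \<open>- t\<close> are
  never both nonzero.\<close>

definition smooth_step :: "real \<Rightarrow> real" where
  "smooth_step t = (let e = \<lambda>t::real. if t > 0 then exp (- inverse t) else 0 in
     e (t - 1/4) / (e (t - 1/4) + e (1/2 - t)))"

lemma Dk_smooth_step: "Dk k UNIV smooth_step"
proof -
  have e: "Dk k UNIV (\<lambda>t::real. if t > 0 then exp (- inverse t) else 0)"
    using Dk_exp_inverse[of k 0] by (simp cong: if_cong)
  have *: "Dk k UNIV (\<lambda>t. (\<lambda>t::real. if t > 0 then exp (- inverse t) else 0) (t - 1/4))"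
    "Dk k UNIV (\<lambda>t. (\<lambda>t::real. if t > 0 then exp (- inverse t) else 0) (1/2 - t))"
    by (rule Dk_compose[OF e Dk_diff[OF Dk_id Dk_const] subset_UNIV])
      (rule Dk_compose[OF e Dk_diff[OF Dk_const Dk_id] subset_UNIV])
  show ?thesis unfolding smooth_step_def[abs_def] Let_def
  proof (intro Dk_divide Dk_add)
    fix t :: real
    \<comment> \<open>Every \<open>t\<close> exceeds 1/4 or lies below 1/2, so at least one of the
      two exponentials is present.\<close>
    show "(if t - 1/4 > 0 then exp (- inverse (t - 1/4)) else 0) +
      (if 1/2 - t > 0 then exp (- inverse (1/2 - t)) else 0) \<noteq> 0"
      using exp_gt_zero[of "- inverse (t - 1/4)"] exp_gt_zero[of "- inverse (1/2 - t)"]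
      by (auto simp del: exp_gt_zero)
  qed (use * in auto)
qed

lemma smooth_step_eq_0: "t \<le> 1/4 \<Longrightarrow> smooth_step t = 0"
  and smooth_step_eq_1: "t \<ge> 1/2 \<Longrightarrow> smooth_step t = 1"
  and smooth_step_nonneg: "smooth_step t \<ge> 0"
  by (auto simp: smooth_step_def Let_def)

subsection \<open>The integrand\<close>

text \<open>The constant 2/5 equals \<open>1 - 3/5\<close>, the value of the lens's support function
  at the poles. Taking it as the floor elsewhere as well makes the poles minima of the integrand,
  which fixes the height of the Wulff shape there.\<close>

definition profile :: "real \<Rightarrow> real" where
  "profile t = 2/5 + 3/5 * (smooth_step t * (1 - t) + smooth_step (- t) * (1 + t))"

lemma profile_ge: "\<bar>t\<bar> \<le> 1 \<Longrightarrow> 2/5 \<le> profile t"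
  by (simp add: profile_def smooth_step_nonneg)

lemma profile_lens: "\<sigma> = 1 \<or> \<sigma> = - 1 \<Longrightarrow> 1/2 \<le> \<sigma> * t \<Longrightarrow> profile t = 1 - 3/5 * \<sigma> * t"
  by (auto simp: profile_def smooth_step_eq_0 smooth_step_eq_1 algebra_simps)

lemma profile_0: "profile 0 = 2/5"
  by (simp add: profile_def smooth_step_eq_0)

definition lens_integrand :: "real^('n::finite option) \<Rightarrow> real" where
  "lens_integrand \<nu> = profile (\<nu> $ None)"

lemma lens_integrand_ge: "norm \<nu> = 1 \<Longrightarrow> 2/5 \<le> lens_integrand \<nu>"
  unfolding lens_integrand_def using component_le_norm_cart[of \<nu> None] by (intro profile_ge) auto

lemma hom_ext_lens: "hom_ext lens_integrand x = norm x * profile (x $ None / norm x)"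
  by (simp add: hom_ext_def lens_integrand_def divide_inverse mult.commute)

lemma smooth_lens_integrand: "smooth_on_sphere (lens_integrand :: real^('n::finite option) \<Rightarrow> real)"
  unfolding smooth_on_sphere_def
proof (rule Dk_imp_Cinf)
  fix k
  have P: "Dk k UNIV profile"
    unfolding profile_def[abs_def]
    by (intro Dk_add Dk_mult Dk_const Dk_diff Dk_smooth_step Dk_id
        Dk_compose[OF Dk_smooth_step Dk_uminus[OF Dk_id] subset_UNIV])
  have "Dk k (- {0}) (\<lambda>x :: real^('n option). x $ None / sqrt (x \<bullet> x))"
    by (intro Dk_divide Dk_sqrt Dk_vec_nth Dk_id Dk_inner) auto
  then have "Dk k (- {0}) (\<lambda>x :: real^('n option). profile (x $ None / sqrt (x \<bullet> x)))"
    by (rule Dk_compose[OF P]) simp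
  then show "Dk k (- {0}) (\<lambda>x :: real^('n option). lens_integrand (x /\<^sub>R norm x))"
    by (simp add: lens_integrand_def norm_eq_sqrt_inner divide_inverse mult.commute)
qed auto

text \<open>The midpoint of \<open>(8/5) u\<close> and \<open>(6/5) e\<close> is a unit vector of
  height 3/5, an edge normal, where the extension takes the value \<open>1 - 9/25 = 16/25\<close>.
  Both \<open>u\<close> and \<open>e\<close> have value 2/5, so the mean of the values at the end
  points is only 14/25.\<close>

lemma not_convex_lens_integrand: "\<not> convex_integrand (lens_integrand :: real^('n::finite option) \<Rightarrow> real)"
proof
  assume "convex_integrand (lens_integrand :: real^('n option) \<Rightarrow> real)"
  then have C: "convex_on UNIV (hom_ext (lens_integrand :: real^('n option) \<Rightarrow> real))"
    by (simp add: convex_integrand_def)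
  define e u :: "real^('n option)" where "e = axis None 1" and "u = axis (Some undefined) 1"
  have ip: "e \<bullet> e = 1" "u \<bullet> u = 1" "e \<bullet> u = 0" "e $ None = 1" "u $ None = 0"
    by (simp_all add: e_def u_def inner_axis_axis, simp_all add: axis_def)
  let ?H = "hom_ext (lens_integrand :: real^('n option) \<Rightarrow> real)"
  have "?H ((1/2) *\<^sub>R ((8/5) *\<^sub>R u) + (1/2) *\<^sub>R ((6/5) *\<^sub>R e)) \<le> (1/2) * ?H ((8/5) *\<^sub>R u) + (1/2) * ?H ((6/5) *\<^sub>R e)"
    using convex_onD[OF C, of "1/2" "(8/5) *\<^sub>R u" "(6/5) *\<^sub>R e"] by simp
  moreover have "norm ((4/5) *\<^sub>R u + (3/5) *\<^sub>R e) = 1"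
    by (simp add: norm_eq_1 inner_simps ip inner_commute[of u e])
  moreover have "norm u = 1" "norm e = 1" by (simp_all add: norm_eq_1 ip)
  ultimately show False
    using profile_lens[of 1 "3/5"] profile_lens[of 1 1] by (simp add: hom_ext_lens ip profile_0)
qed

text \<open>On the open cone \<open>?S\<close> the homogeneous extension is
  \<open>norm x - 3/5 * \<sigma> * x $ None\<close>, the support function of the unit ball centred
  at height \<open>- 3/5 * \<sigma>\<close> on the axis. The strict bound in the hypothesis puts
  \<open>\<nu>\<close> inside this cone, so the gradient can be read off from the formula.\<close>

lemma cahn_hoffman_lens:
  fixes \<nu> :: "real^('n::finite option)"
  assumes "\<sigma> = 1 \<or> \<sigma> = - 1" "norm \<nu> = 1" "1/2 < \<sigma> * \<nu> $ None"
  shows "cahn_hoffman lens_integrand \<nu> = \<nu> - (3/5 * \<sigma>) *\<^sub>R axis None 1"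
proof -
  let ?S = "{x :: real^('n option). norm x / 2 < \<sigma> * x $ None}"
  have op: "open ?S" by (auto intro!: open_Collect_less continuous_intros)
  have nz: "x \<noteq> 0" if "x \<in> ?S" for x using that by auto
  have "((\<lambda>x. norm x - 3/5 * \<sigma> * x $ None) has_derivative (\<lambda>h. h \<bullet> sgn \<nu> - 3/5 * \<sigma> * h $ None)) (at \<nu>)"
    using assms by (auto intro!: derivative_eq_intros has_derivative_norm bounded_linear.has_derivative[OF bounded_linear_vec_nth] simp: inner_commute)
  then have "(hom_ext lens_integrand has_derivative (\<lambda>h. h \<bullet> sgn \<nu> - 3/5 * \<sigma> * h $ None)) (at \<nu>)"
  proof (rule has_derivative_transform_within_open[OF _ op])
    show "\<nu> \<in> ?S" using assms by simp
    fix x assume x: "x \<in> ?S"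
    then have "norm x > 0" using nz by simp
    then have "1/2 \<le> \<sigma> * (x $ None / norm x)" using x by (simp add: field_simps)
    then show "norm x - 3/5 * \<sigma> * x $ None = hom_ext lens_integrand x"
      using profile_lens[OF assms(1)] nz[OF x] by (simp add: hom_ext_lens right_diff_distrib)
  qed
  from dpart_eq[OF this] have "dpart (axis r 1) (hom_ext lens_integrand) \<nu> = \<nu> $ r - 3/5 * \<sigma> * axis r 1 $ None" for r
    using assms by (simp add: inner_axis' sgn_div_norm)
  then show ?thesis
    by (auto simp: cahn_hoffman_def vec_eq_iff axis_def)
qed

section \<open>Comparison with the Wulff shape\<close>

lemma wulff_shape_subset: "wulff_shape \<gamma> \<subseteq> (\<Inter>\<nu>\<in>sphere 0 1. {x. x \<bullet> \<nu> \<le> \<gamma> \<nu>})"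
proof -
  have "closed (\<Inter>\<nu>\<in>sphere 0 1. {x. x \<bullet> \<nu> \<le> \<gamma> \<nu>})"
    by (auto intro!: closed_Collect_le continuous_intros)
  then show ?thesis by (simp add: wulff_shape_def frontier_def closure_closed Diff_subset)
qed

text \<open>The integrand is at least 2/5, so the ball of radius 2/5 lies in every half-space. In
  direction \<open>\<sigma> *\<^sub>R e\<close> the value 2/5 is attained, so any step outwards from
  the pole leaves the half-space with that normal.\<close>

lemma poles_in_wulff_shape_lens:
  assumes "\<sigma> = 1 \<or> \<sigma> = (- 1 :: real)"
  shows "(2/5 * \<sigma>) *\<^sub>R axis None 1 \<in> wulff_shape (lens_integrand :: real^('n::finite option) \<Rightarrow> real)"
proof -
  define e :: "real^('n option)" where "e = axis None 1"
  have "e \<bullet> e = 1" by (simp add: e_def inner_axis_axis)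
  with assms have e: "norm (\<sigma> *\<^sub>R e) = 1" "e \<bullet> e = 1" "e $ None = 1" "\<sigma> * \<sigma> = 1"
    by (auto simp: e_def norm_eq_1 axis_def)
  define K where "K = (\<Inter>\<nu>\<in>sphere 0 1. {x. x \<bullet> \<nu> \<le> (lens_integrand :: real^('n option) \<Rightarrow> real) \<nu>})"
  have "(2/5 * \<sigma>) *\<^sub>R e \<in> K"
    unfolding K_def
  proof (intro INT_I CollectI)
    fix \<nu> :: "real^('n option)" assume "\<nu> \<in> sphere 0 1"
    then have n: "norm \<nu> = 1" by simp
    have "((2/5 * \<sigma>) *\<^sub>R e) \<bullet> \<nu> = 2/5 * (\<sigma> * \<nu> $ None)" by (simp add: e_def inner_axis')
    also have "\<dots> \<le> 2/5" using component_le_norm_cart[of \<nu> None] n assms by auto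
    also have "\<dots> \<le> lens_integrand \<nu>" by (rule lens_integrand_ge[OF n])
    finally show "((2/5 * \<sigma>) *\<^sub>R e) \<bullet> \<nu> \<le> lens_integrand \<nu>" .
  qed
  moreover have "(2/5 * \<sigma>) *\<^sub>R e \<notin> interior K"
  proof
    assume "(2/5 * \<sigma>) *\<^sub>R e \<in> interior K"
    then obtain d where d: "d > 0" "cball ((2/5 * \<sigma>) *\<^sub>R e) d \<subseteq> K" by (meson mem_interior_cball)
    have inK: "(2/5 * \<sigma>) *\<^sub>R e + d *\<^sub>R (\<sigma> *\<^sub>R e) \<in> K"
      using d by (intro subsetD[OF d(2)]) (use e in \<open>simp add: dist_norm del: scaleR_scaleR\<close>)
    have "((2/5 * \<sigma>) *\<^sub>R e + d *\<^sub>R (\<sigma> *\<^sub>R e)) \<bullet> (\<sigma> *\<^sub>R e) \<le> lens_integrand (\<sigma> *\<^sub>R e)"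
    proof -
      have "\<sigma> *\<^sub>R e \<in> sphere 0 1" using e(1) by simp
      with inK show ?thesis unfolding K_def by blast
    qed
    moreover have "lens_integrand (\<sigma> *\<^sub>R e) = 2/5"
      using profile_lens[OF assms, of \<sigma>] e by (simp add: lens_integrand_def mult.assoc)
    ultimately show False using e d assms by (auto simp: inner_simps algebra_simps)
  qed
  ultimately show ?thesis
    unfolding wulff_shape_def frontier_def K_def[symmetric] e_def[symmetric]
    using closure_subset by blast
qed

text \<open>The Wulff shape is as high as the lens in direction \<open>axis None 1\<close> but at most half as wide in the
  horizontal directions.\<close>

lemma lens_not_homothetic_wulff:
  fixes L :: "(real^('n::finite option)) set"
  assumes height: "\<And>x. x \<in> L \<Longrightarrow> \<bar>x $ None\<bar> \<le> 2/5"
    and equator: "\<And>\<sigma>. \<sigma> = 1 \<or> \<sigma> = - 1 \<Longrightarrow> (4/5 * \<sigma>) *\<^sub>R axis (Some j) 1 \<in> L"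
    and "a > 0"
  shows "L \<noteq> (\<lambda>x. a *\<^sub>R x + b) ` wulff_shape lens_integrand"
proof
  assume L: "L = (\<lambda>x. a *\<^sub>R x + b) ` wulff_shape lens_integrand"
  have "a *\<^sub>R ((2/5 * \<sigma>) *\<^sub>R axis None 1) + b \<in> L" if "\<sigma> = 1 \<or> \<sigma> = - 1" for \<sigma>
    using poles_in_wulff_shape_lens[OF that] L by blast
  from height[OF this[of 1]] height[OF this[of "-1"]]
  have "\<bar>a * 2/5 + b $ None\<bar> \<le> 2/5" "\<bar>b $ None - a * 2/5\<bar> \<le> 2/5"
    by (simp_all add: axis_def)
  \<comment> \<open>The images of the two poles differ in height by \<open>4/5 * a\<close>, while
    \<open>L\<close> lies in a slab of height 4/5.\<close>
  then have a: "a \<le> 1" unfolding abs_le_iff by linarith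
  obtain p where p: "p \<in> wulff_shape lens_integrand" "(4/5) *\<^sub>R axis (Some j) 1 = a *\<^sub>R p + b"
    using equator[of 1] L by auto
  obtain q where q: "q \<in> wulff_shape lens_integrand" "- ((4/5) *\<^sub>R axis (Some j) 1) = a *\<^sub>R q + b"
    using equator[of "-1"] L by auto
  have E: "lens_integrand (axis (Some j) 1) = 2/5" "lens_integrand (- axis (Some j) 1) = 2/5"
    by (auto simp: lens_integrand_def axis_def profile_0)
  have "p \<bullet> axis (Some j) 1 \<le> 2/5" "q \<bullet> (- axis (Some j) 1) \<le> 2/5"
    using INT_D[OF subsetD[OF wulff_shape_subset p(1)], of "axis (Some j) 1"]
      INT_D[OF subsetD[OF wulff_shape_subset q(1)], of "- axis (Some j) 1"] E
    by simp_all
  then have pq: "p $ Some j - q $ Some j \<le> 4/5" by (simp add: inner_axis)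
  have "4/5 = a * p $ Some j + b $ Some j" "- (4/5) = a * q $ Some j + b $ Some j"
    using arg_cong[OF p(2), of "\<lambda>x. x $ Some j"] arg_cong[OF q(2), of "\<lambda>x. x $ Some j"]
    by (auto simp: axis_def)
  then have "8/5 = a * (p $ Some j - q $ Some j)" by (simp add: algebra_simps)
  also have "\<dots> \<le> a * (4/5)" using pq \<open>a > 0\<close> by (intro mult_left_mono) auto
  also have "\<dots> \<le> 4/5" using a by simp
  finally show False by simp
qed

subsection \<open>Stereographic projection\<close>

lemma inner_option:
  fixes p q :: "real^('n::finite option)"
  shows "p \<bullet> q = p $ None * q $ None + (\<chi> k. p $ Some k) \<bullet> (\<chi> k. q $ Some k)"
  by (simp add: inner_vec_def UNIV_option_conv sum.reindex)

lemma vec_option_eqI: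
  fixes p q :: "real^('n::finite option)"
  assumes "p $ None = q $ None" "(\<chi> k. p $ Some k) = (\<chi> k. q $ Some k)"
  shows "p = q"
  unfolding vec_eq_iff
proof
  fix a show "p $ a = q $ a" using assms by (cases a) (auto simp: vec_eq_iff)
qed

text \<open>Here \<open>undefined\<close> serves as an arbitrary fixed index of the nonempty type
  \<open>'n\<close>. The sign parameter treats the identity and the reflection in that coordinate
  together.\<close>

definition reflect :: "real \<Rightarrow> real^'n::finite \<Rightarrow> real^'n" where
  "reflect \<sigma> x = (\<chi> k. (if k = undefined then \<sigma> else 1) * x $ k)"

lemma linear_reflect: "linear (reflect \<sigma>)"
  by (rule linearI) (auto simp: reflect_def vec_eq_iff algebra_simps)

lemma reflect_scaleR: "reflect \<sigma> (c *\<^sub>R x) = c *\<^sub>R reflect \<sigma> x"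
  by (rule linear_cmul[OF linear_reflect])

lemma reflect_reflect: "\<sigma> = 1 \<or> \<sigma> = - 1 \<Longrightarrow> reflect \<sigma> (reflect \<sigma> x) = x"
  by (auto simp: reflect_def vec_eq_iff)

lemma inner_reflect: "\<sigma> = 1 \<or> \<sigma> = - 1 \<Longrightarrow> reflect \<sigma> x \<bullet> reflect \<sigma> x = x \<bullet> x"
  by (auto simp: reflect_def inner_vec_def intro!: sum.cong)

text \<open>The two stereographic projections, distinguished by the sign \<open>\<sigma>\<close>. The reflection makes them induce
  the same orientation.\<close>

definition stereo :: "real \<Rightarrow> real^('n::finite option) \<Rightarrow> real^'n" where
  "stereo \<sigma> p = (1 / (1 + \<sigma> * p $ None)) *\<^sub>R reflect \<sigma> (\<chi> k. p $ Some k)"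

text \<open>The projection is from the pole of height \<open>- \<sigma>\<close>: the origin
  corresponds to the pole of height \<open>\<sigma>\<close>, and the closed unit ball to the
  hemisphere around it.\<close>

definition stereo_inv :: "real \<Rightarrow> real^'n::finite \<Rightarrow> real^('n option)" where
  "stereo_inv \<sigma> x = (1 / (1 + x \<bullet> x)) *\<^sub>R
     (\<chi> a. case a of None \<Rightarrow> \<sigma> * (1 - x \<bullet> x) | Some k \<Rightarrow> 2 * reflect \<sigma> x $ k)"

lemma one_plus_inner_pos: "0 < 1 + x \<bullet> (x :: 'a::real_inner)"
  by (simp add: add_pos_nonneg)

lemma stereo_inv_None: "stereo_inv \<sigma> x $ None = \<sigma> * (1 - x \<bullet> x) / (1 + x \<bullet> x)"
  by (simp add: stereo_inv_def)

lemma stereo_inv_Some: "(\<chi> k. stereo_inv \<sigma> x $ Some k) = (2 / (1 + x \<bullet> x)) *\<^sub>R reflect \<sigma> x"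
  by (simp add: stereo_inv_def vec_eq_iff)

lemma norm_stereo_inv:
  assumes "\<sigma> = 1 \<or> \<sigma> = - 1"
  shows "norm (stereo_inv \<sigma> x) = 1"
proof -
  define r where "r = x \<bullet> x"
  have r: "1 + r > 0" unfolding r_def by (rule one_plus_inner_pos)
  have "stereo_inv \<sigma> x \<bullet> stereo_inv \<sigma> x = (\<sigma> * (1 - r) / (1 + r))\<^sup>2 + (2 / (1 + r))\<^sup>2 * r"
    by (simp add: inner_option stereo_inv_None stereo_inv_Some inner_reflect[OF assms] r_def power2_eq_square)
  also have "\<dots> = (\<sigma>\<^sup>2 * (1 - r)\<^sup>2 + 4 * r) / (1 + r)\<^sup>2"
    by (simp add: power_divide power_mult_distrib add_divide_distrib)
  also have "\<sigma>\<^sup>2 * (1 - r)\<^sup>2 + 4 * r = (1 + r)\<^sup>2"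
    using assms by (auto simp: power2_eq_square algebra_simps)
  finally show ?thesis using r by (simp add: norm_eq_1)
qed

lemma stereo_inv_None_pos:
  assumes "\<sigma> = 1 \<or> \<sigma> = - 1"
  shows "1 + \<sigma> * stereo_inv \<sigma> x $ None = 2 / (1 + x \<bullet> x)"
  using assms one_plus_inner_pos[of x] by (auto simp: stereo_inv_None field_simps)

lemma stereo_stereo_inv:
  assumes "\<sigma> = 1 \<or> \<sigma> = - 1"
  shows "stereo \<sigma> (stereo_inv \<sigma> x) = x"
proof -
  have "1 / (2 / (1 + x \<bullet> x)) * (2 / (1 + x \<bullet> x)) = 1" using one_plus_inner_pos[of x] by simp
  then show ?thesis
    by (simp only: stereo_def stereo_inv_None_pos[OF assms] stereo_inv_Some reflect_scaleR
        reflect_reflect[OF assms] scaleR_scaleR scaleR_one)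
qed

lemma stereo_inv_stereo:
  assumes \<sigma>: "\<sigma> = 1 \<or> \<sigma> = - 1" and "norm p = 1" "\<sigma> * p $ None \<noteq> - 1"
  shows "stereo_inv \<sigma> (stereo \<sigma> p) = p"
proof -
  define z t where "z = \<sigma> * p $ None" and "t = (\<chi> k. p $ Some k)"
  have z: "1 + z \<noteq> 0" using assms(3) by (simp add: z_def)
  have "z\<^sup>2 = (p $ None)\<^sup>2" using \<sigma> by (auto simp: z_def)
  then have "t \<bullet> t = 1 - z\<^sup>2"
    using \<open>norm p = 1\<close> inner_option[of p p] by (simp add: norm_eq_1 t_def power2_eq_square)
  then have "stereo \<sigma> p \<bullet> stereo \<sigma> p = (1 - z\<^sup>2) / (1 + z)\<^sup>2"
    by (simp add: stereo_def inner_reflect[OF \<sigma>] z_def t_def power2_eq_square)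
  also have "\<dots> = (1 - z) / (1 + z)"
  proof -
    have "1 - z\<^sup>2 = (1 - z) * (1 + z)" by (simp add: power2_eq_square algebra_simps)
    then show ?thesis using z by (simp add: power2_eq_square)
  qed
  finally have r: "stereo \<sigma> p \<bullet> stereo \<sigma> p = (1 - z) / (1 + z)" .
  then have r1: "1 + stereo \<sigma> p \<bullet> stereo \<sigma> p = 2 / (1 + z)" "1 - stereo \<sigma> p \<bullet> stereo \<sigma> p = 2 * z / (1 + z)"
    using z by (simp_all add: field_simps)
  have "p $ None = \<sigma> * z" using \<sigma> by (auto simp: z_def)
  then have "stereo_inv \<sigma> (stereo \<sigma> p) $ None = p $ None"
    using z unfolding stereo_inv_None r1 by (auto simp: field_simps)
  moreover have "(\<chi> k. stereo_inv \<sigma> (stereo \<sigma> p) $ Some k) = t"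
    using z unfolding stereo_inv_Some r1
    by (simp add: stereo_def reflect_scaleR reflect_reflect[OF \<sigma>] z_def t_def)
  ultimately show ?thesis
    unfolding t_def by (rule vec_option_eqI)
qed

lemma Dk_reflect: "Dk k U (\<lambda>x. reflect \<sigma> x)"
  by (rule Dk_linear) (simp add: linear_linear linear_conv_bounded_linear[symmetric] linear_reflect)

lemma Dk_stereo: "Dk k {p. \<sigma> * p $ None \<noteq> - 1} (stereo \<sigma>)"
proof -
  have "Dk k {p :: real^('a option). \<sigma> * p $ None \<noteq> - 1} (\<lambda>p. reflect \<sigma> (\<chi> k. p $ Some k))"
    by (rule Dk_compose[OF Dk_reflect[of _ UNIV]]) (intro Dk_vec_lambda Dk_vec_nth Dk_id, simp)
  then show ?thesis
    unfolding stereo_def[abs_def]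
    by (intro Dk_scaleR Dk_divide Dk_const Dk_add Dk_mult Dk_vec_nth Dk_id) auto
qed

lemma Dk_stereo_inv: "Dk k U (stereo_inv \<sigma>)"
proof -
  have "Dk k U (\<lambda>x. case a of None \<Rightarrow> \<sigma> * (1 - x \<bullet> x) | Some k \<Rightarrow> 2 * reflect \<sigma> x $ k)" for a
    by (cases a) (auto intro!: Dk_mult Dk_const Dk_diff Dk_inner Dk_id Dk_vec_nth Dk_reflect)
  then show ?thesis
    unfolding stereo_inv_def[abs_def]
    by (intro Dk_scaleR Dk_divide Dk_const Dk_add Dk_inner Dk_id Dk_vec_lambda
        less_imp_neq[OF one_plus_inner_pos, THEN not_sym])
qed

lemma open_stereo_domain: "open {p :: real^('n::finite option). \<sigma> * p $ None \<noteq> - 1}"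
  by (intro open_Collect_neq continuous_intros)

lemma det_diagonal_pos:
  fixes A :: "real^'n::finite^'n"
  assumes "\<And>i j. i \<noteq> j \<Longrightarrow> A $ i $ j = 0" "(\<Prod>i\<in>UNIV. A $ i $ i) > 0"
  shows "det A > 0"
  using det_diagonal[of A] assms by auto

text \<open>This is the matrix whose determinant \<open>pos_normal_at\<close> tests. Splitting its
  action into a normal and a tangential part is what shows that its kernel is trivial.\<close>

lemma frame_matrix_mult:
  fixes Y' :: "real^'n::finite \<Rightarrow> real^('n option)"
  assumes "linear Y'"
  shows "(\<chi> a b. (case b of None \<Rightarrow> \<nu> | Some j \<Rightarrow> Y' (axis j 1)) $ a) *v w =
    w $ None *\<^sub>R \<nu> + Y' (\<chi> k. w $ Some k)"
proof -
  have "Y' (\<chi> k. w $ Some k) = Y' (\<Sum>k\<in>UNIV. w $ Some k *\<^sub>R axis k 1)"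
    by (rule arg_cong[of _ _ Y']) (auto simp: vec_eq_iff axis_def if_distrib cong: if_cong)
  also have "\<dots> = (\<Sum>k\<in>UNIV. w $ Some k *\<^sub>R Y' (axis k 1))"
    by (simp add: linear_sum[OF assms] linear_cmul[OF assms])
  finally show ?thesis
    by (simp add: vec_eq_iff matrix_vector_mult_def UNIV_option_conv sum.reindex mult.commute)
qed

text \<open>The position vector of the unit sphere is its normal, by differentiating
  \<open>Y x \<bullet> Y x = 1\<close>. The dilation \<open>c\<close> is included because each half
  of the lens is, in a chart, a translate of this map. The orientation is computed at the origin,
  where the frame is diagonal.\<close>

lemma pos_normal_stereo_inv:
  fixes x :: "real^'n::finite"
  assumes \<sigma>: "\<sigma> = 1 \<or> \<sigma> = - 1" and "c > 0"
  shows "pos_normal_at TYPE('n) (\<lambda>x. stereo_inv \<sigma> (c *\<^sub>R x)) x (stereo_inv \<sigma> (c *\<^sub>R x))"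
proof -
  define Y :: "real^'n \<Rightarrow> real^('n option)" where "Y = (\<lambda>x. stereo_inv \<sigma> (c *\<^sub>R x))"
  have "Dk (Suc 0) UNIV Y"
    unfolding Y_def
    by (rule Dk_compose[OF Dk_stereo_inv[of _ UNIV] Dk_linear[OF bounded_linear_scaleR_right]]) simp
  then obtain Y' where Y': "\<And>x. (Y has_derivative Y' x) (at x)"
    and cont: "\<And>v. v \<in> Basis \<Longrightarrow> continuous_on UNIV (\<lambda>x. Y' x v)"
    by auto
  have lin: "linear (Y' x)" for x using Y' has_derivative_linear by blast
  have dp: "dpart v Y x = Y' x v" for v x by (rule dpart_eq[OF Y'])
  have unit: "norm (Y x) = 1" for x by (simp add: Y_def norm_stereo_inv[OF \<sigma>])
  have orth: "Y x \<bullet> Y' x v = 0" for x v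
  proof -
    have "((\<lambda>x. Y x \<bullet> Y x) has_derivative (\<lambda>v. Y x \<bullet> Y' x v + Y' x v \<bullet> Y x)) (at x)"
      by (intro has_derivative_inner Y')
    moreover have "(\<lambda>x. Y x \<bullet> Y x) = (\<lambda>x. 1)" using unit by (auto simp: norm_eq_1)
    ultimately have "(\<lambda>v. Y x \<bullet> Y' x v + Y' x v \<bullet> Y x) = (\<lambda>v. 0)"
      using has_derivative_unique[OF _ has_derivative_const[of 1 "at x"]] by auto
    from fun_cong[OF this, of v] show ?thesis by (simp add: inner_commute)
  qed
  \<comment> \<open>differentiate \<open>stereo \<sigma> (Y x) = c *\<^sub>R x\<close>\<close>
  have inj: "v = 0" if "Y' x v = 0" for x v
  proof -
    have "Y x \<in> {p. \<sigma> * p $ None \<noteq> - 1}"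
      using stereo_inv_None_pos[OF \<sigma>, of "c *\<^sub>R x"] one_plus_inner_pos[of "c *\<^sub>R x"]
      by (auto simp: Y_def)
    then obtain F where F: "(stereo \<sigma> has_derivative F) (at (Y x))"
      using Dk_stereo[of "Suc 0" \<sigma>] by auto
    have "((\<lambda>x. stereo \<sigma> (Y x)) has_derivative (\<lambda>v. F (Y' x v))) (at x)"
      by (rule has_derivative_compose[OF Y' F])
    moreover have "(\<lambda>x. stereo \<sigma> (Y x)) = (\<lambda>x. c *\<^sub>R x)"
      by (auto simp: Y_def stereo_stereo_inv[OF \<sigma>])
    ultimately have "((\<lambda>x. c *\<^sub>R x) has_derivative (\<lambda>v. F (Y' x v))) (at x)" by simp
    then have "(\<lambda>v. F (Y' x v)) = (\<lambda>v. c *\<^sub>R v)"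
      by (rule has_derivative_unique) (auto intro!: derivative_eq_intros)
    from fun_cong[OF this, of v] that have "c *\<^sub>R v = 0"
      using linear_0[OF has_derivative_linear[OF F]] by simp
    with \<open>c > 0\<close> show ?thesis by simp
  qed
  define D where "D x = det (\<chi> a b. (case b of None \<Rightarrow> Y x | Some j \<Rightarrow> Y' x (axis j 1)) $ a)" for x
  have "D x \<noteq> 0" for x
  proof -
    let ?A = "(\<chi> a b. (case b of None \<Rightarrow> Y x | Some j \<Rightarrow> Y' x (axis j 1)) $ a)"
    \<comment> \<open>Pairing with \<open>Y x\<close> isolates the normal coefficient, since
      \<open>Y x\<close> is orthogonal to the image of \<open>Y' x\<close>; injectivity of
      \<open>Y' x\<close> removes the rest.\<close>
    have "w = 0" if "?A *v w = 0" for w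
    proof -
      have eq: "w $ None *\<^sub>R Y x + Y' x (\<chi> k. w $ Some k) = 0"
        using that frame_matrix_mult[OF lin, of "Y x" x w] by simp
      have "Y x \<bullet> (w $ None *\<^sub>R Y x + Y' x (\<chi> k. w $ Some k)) = w $ None"
        using unit[of x] by (simp add: inner_simps orth norm_eq_1)
      with eq have w0: "w $ None = 0" by simp
      with eq have "(\<chi> k. w $ Some k) = 0" using inj by simp
      with w0 show "w = 0" by (auto simp: vec_eq_iff) (metis option.exhaust)
    qed
    then have "invertible ?A"
      using matrix_left_invertible_ker invertible_left_inverse by blast
    then show ?thesis unfolding D_def by (simp add: invertible_det_nz)
  qed
  moreover have "continuous_on UNIV D"
  proof -
    have C: "continuous_on UNIV (\<lambda>x. (case b of None \<Rightarrow> Y x | Some j \<Rightarrow> Y' x (axis j 1)) $ a)" for a b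
    proof (cases b)
      case None
      have "continuous_on UNIV Y"
        using has_derivative_continuous[OF Y'] by (simp add: continuous_on_eq_continuous_at)
      with None show ?thesis by (auto intro!: continuous_intros)
    next
      case (Some j)
      have "axis j (1 :: real) \<in> Basis" by (auto simp: Basis_vec_def)
      with Some cont show ?thesis by (auto intro!: continuous_intros)
    qed
    show ?thesis unfolding D_def det_def vec_lambda_beta
      by (intro continuous_on_sum continuous_on_mult continuous_on_const continuous_on_prod C)
  qed
  moreover have "D 0 > 0"
    unfolding D_def
  proof (rule det_diagonal_pos)
    define L :: "real^'n \<Rightarrow> real^('n option)"
      where "L v = (\<chi> a. case a of None \<Rightarrow> 0 | Some k \<Rightarrow> 2 * c * reflect \<sigma> v $ k)" for v
    have "linear L"
      by (rule linearI) (auto simp: L_def vec_eq_iff reflect_def algebra_simps split: option.split)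
    then have L: "(L has_derivative L) (at 0)"
      by (simp add: linear_imp_has_derivative)
    \<comment> \<open>In this form the terms in \<open>x \<bullet> x\<close> are visibly of second
      order, so that the derivative at 0 is the linear part \<open>L\<close>.\<close>
    have "(\<lambda>x. stereo_inv \<sigma> (c *\<^sub>R x)) =
      (\<lambda>x. inverse (1 + c\<^sup>2 * (x \<bullet> x)) *\<^sub>R ((\<sigma> * (1 - c\<^sup>2 * (x \<bullet> x))) *\<^sub>R axis None 1 + L x))"
      by (auto simp: stereo_inv_def L_def vec_eq_iff axis_def reflect_scaleR power2_eq_square
          divide_inverse mult.assoc split: option.split)
    moreover have "((\<lambda>x. inverse (1 + c\<^sup>2 * (x \<bullet> x)) *\<^sub>R ((\<sigma> * (1 - c\<^sup>2 * (x \<bullet> x))) *\<^sub>R axis None 1 + L x))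
      has_derivative L) (at 0)"
      using linear_0[OF \<open>linear L\<close>] by (auto intro!: derivative_eq_intros L)
    ultimately have "(Y has_derivative L) (at 0)" unfolding Y_def by simp
    then have "Y' 0 = L" using Y' has_derivative_unique by blast
    moreover have "Y 0 = axis None \<sigma>"
      by (auto simp: Y_def stereo_inv_def reflect_def vec_eq_iff axis_def split: option.split)
    ultimately have M: "(\<chi> a b. (case b of None \<Rightarrow> Y 0 | Some j \<Rightarrow> Y' 0 (axis j 1)) $ a) $ a $ b =
      (if a \<noteq> b then 0 else case a of None \<Rightarrow> \<sigma> | Some k \<Rightarrow> 2 * c * (if k = undefined then \<sigma> else 1))" for a b
      by (auto simp: L_def axis_def reflect_def split: option.split)
    show "(\<chi> a b. (case b of None \<Rightarrow> Y 0 | Some j \<Rightarrow> Y' 0 (axis j 1)) $ a) $ a $ b = 0" if "a \<noteq> b" for a b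
      using that unfolding M by simp
    have "(\<Prod>a\<in>(UNIV :: 'n option set). (case a of None \<Rightarrow> \<sigma> | Some k \<Rightarrow> 2 * c * (if k = undefined then \<sigma> else 1))) =
      \<sigma> * (\<Prod>k\<in>(UNIV :: 'n set). 2 * c * (if k = undefined then \<sigma> else 1))"
      by (simp add: UNIV_option_conv prod.reindex)
    \<comment> \<open>The sign of the normal entry is cancelled by that of the reflected coordinate,
      as \<open>\<sigma> * \<sigma> = 1\<close>. This is the purpose of the reflection in
      \<open>stereo\<close>.\<close>
    also have "\<dots> = \<sigma> * ((2 * c * \<sigma>) * (\<Prod>k\<in>UNIV - {undefined :: 'n}. 2 * c))"
      by (subst prod.remove[of _ undefined]) (auto intro!: prod.cong)
    also have "\<dots> > 0"
    proof -
      have "(\<Prod>k\<in>UNIV - {undefined :: 'n}. 2 * c) > 0" using \<open>c > 0\<close> by (intro prod_pos) auto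
      then show ?thesis using \<sigma> \<open>c > 0\<close> by (auto simp del: prod_constant)
    qed
    finally show "(\<Prod>i\<in>UNIV. (\<chi> a b. (case b of None \<Rightarrow> Y 0 | Some j \<Rightarrow> Y' 0 (axis j 1)) $ a) $ i $ i) > 0"
      unfolding M by simp
  qed
  \<comment> \<open>\<open>D\<close> has no zero on the connected domain, so its sign is the one at \<open>0\<close>\<close>
  ultimately have "D x > 0" for x
  proof -
    have "connected (D ` UNIV)" by (rule connected_continuous_image) (use \<open>continuous_on UNIV D\<close> in auto)
    from connectedD_interval[OF this, of "D x" "D 0" 0] show ?thesis
      using \<open>D 0 > 0\<close> \<open>\<And>x. D x \<noteq> 0\<close> by (metis imageE less_imp_le not_less rangeI)
  qed
  moreover have "\<forall>j. k j = 0" if "(\<Sum>j\<in>UNIV. k j *\<^sub>R Y' x (axis j 1)) = 0" for k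
  proof -
    have "Y' x (\<Sum>j\<in>UNIV. k j *\<^sub>R axis j 1) = 0"
      using that by (simp add: linear_sum[OF lin] linear_cmul[OF lin])
    then have "(\<Sum>j\<in>UNIV. k j *\<^sub>R axis j 1) = (0 :: real^'n)" by (rule inj)
    then show ?thesis by (auto simp: vec_eq_iff axis_def if_distrib cong: if_cong)
  qed
  ultimately have "pos_normal_at TYPE('n) Y x (Y x)"
    unfolding pos_normal_at_def dp by (auto simp: unit orth D_def)
  then show ?thesis by (simp add: Y_def)
qed

subsection \<open>The sphere as an oriented manifold\<close>

text \<open>A chart of \<open>M\<close> that is the restriction of a smooth map \<open>\<phi>\<close> on the ambient open set \<open>D\<close> and whose inverse
  \<open>\<psi>\<close> is smooth as a map into the ambient space.\<close>

definition ambient_chart ::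
  "'a::euclidean_space set \<Rightarrow> 'a set \<Rightarrow> ('a \<Rightarrow> real^'n::finite) \<Rightarrow> (real^'n) set \<Rightarrow> (real^'n \<Rightarrow> 'a) \<Rightarrow> bool" where
  "ambient_chart M D \<phi> V \<psi> \<longleftrightarrow> open D \<and> open V \<and> (\<forall>k. Dk k D \<phi>) \<and> (\<forall>k. Dk k V \<psi>) \<and>
     (\<forall>p\<in>M \<inter> D. \<phi> p \<in> V \<and> \<psi> (\<phi> p) = p) \<and> (\<forall>x\<in>V. \<psi> x \<in> M \<inter> D \<and> \<phi> (\<psi> x) = x)"

lemma ambient_chart_image: "ambient_chart M D \<phi> V \<psi> \<Longrightarrow> \<phi> ` (M \<inter> D) = V"
  unfolding ambient_chart_def by (metis (no_types, lifting) image_iff subsetI subset_antisym)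

lemma ambient_chart_inv_into:
  assumes "ambient_chart M D \<phi> V \<psi>" "x \<in> V"
  shows "inv_into (M \<inter> D) \<phi> x = \<psi> x"
proof -
  have "inj_on \<phi> (M \<inter> D)" using assms by (intro inj_on_inverseI[of _ \<psi>]) (auto simp: ambient_chart_def)
  moreover have "\<psi> x \<in> M \<inter> D" "\<phi> (\<psi> x) = x" using assms by (auto simp: ambient_chart_def)
  ultimately show ?thesis by (metis inv_into_f_f)
qed

lemma ambient_chart_is_chart:
  assumes A: "ambient_chart M D \<phi> V \<psi>"
  shows "is_chart (top_of_set M) (M \<inter> D) \<phi>"
proof -
  have "homeomorphic_maps (top_of_set (M \<inter> D)) (top_of_set V) \<phi> \<psi>"
    using A Dk_continuous[of 0 D \<phi>] Dk_continuous[of 0 V \<psi>]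
    unfolding homeomorphic_maps_def ambient_chart_def
    by (auto intro: continuous_on_subset)
  then show ?thesis
    using A unfolding is_chart_def ambient_chart_image[OF A]
    by (auto simp: subtopology_subtopology ambient_chart_def openin_open_Int homeomorphic_maps_imp_map)
qed

text \<open>The transition map is \<open>\<phi>2\<close> after \<open>\<psi>1\<close>, a composition
  through the ambient space of maps that are smooth on open sets.\<close>

lemma ambient_chart_transition:
  assumes A1: "ambient_chart M D1 \<phi>1 V1 \<psi>1" and A2: "ambient_chart M D2 \<phi>2 V2 \<psi>2"
  shows "\<phi>1 ` ((M \<inter> D1) \<inter> (M \<inter> D2)) = V1 \<inter> \<psi>1 -` D2" "open (V1 \<inter> \<psi>1 -` D2)"
    "Cinf (\<phi>1 ` ((M \<inter> D1) \<inter> (M \<inter> D2))) (\<phi>2 \<circ> inv_into (M \<inter> D1) \<phi>1)"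
proof -
  show im: "\<phi>1 ` ((M \<inter> D1) \<inter> (M \<inter> D2)) = V1 \<inter> \<psi>1 -` D2"
    using A1 unfolding ambient_chart_def by (auto simp: image_iff) (metis Int_iff)
  show op: "open (V1 \<inter> \<psi>1 -` D2)"
    using A1 A2 Dk_continuous[of 0 V1 \<psi>1] unfolding ambient_chart_def
    by (intro continuous_open_preimage) auto
  show "Cinf (\<phi>1 ` ((M \<inter> D1) \<inter> (M \<inter> D2))) (\<phi>2 \<circ> inv_into (M \<inter> D1) \<phi>1)"
    unfolding im
  proof (rule Dk_imp_Cinf[OF op])
    fix k
    have "Dk k (V1 \<inter> \<psi>1 -` D2) (\<lambda>x. \<phi>2 (\<psi>1 x))"
      using A1 A2 unfolding ambient_chart_def
      by (intro Dk_compose[of k D2 \<phi>2 _ \<psi>1]) (auto intro: Dk_subset)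
    then show "Dk k (V1 \<inter> \<psi>1 -` D2) (\<phi>2 \<circ> inv_into (M \<inter> D1) \<phi>1)"
      by (rule Dk_cong[OF op, rotated]) (simp add: ambient_chart_inv_into[OF A1])
  qed
qed

lemma ambient_chart_smooth_compat:
  assumes "ambient_chart M D1 \<phi>1 V1 \<psi>1" "ambient_chart M D2 \<phi>2 V2 \<psi>2"
  shows "smooth_compat (M \<inter> D1) \<phi>1 (M \<inter> D2) \<phi>2"
  unfolding smooth_compat_def
  using ambient_chart_transition(3)[OF assms] ambient_chart_transition(3)[OF assms(2,1)]
  by (simp add: Int_commute)

lemma ambient_chart_restrict:
  assumes A: "ambient_chart M D \<phi> V \<psi>" and "open D'" "D' \<subseteq> D"
  shows "ambient_chart M D' \<phi> (V \<inter> \<psi> -` D') \<psi>"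
proof -
  have "open (V \<inter> \<psi> -` D')"
    using A assms(2) Dk_continuous[of 0 V \<psi>] unfolding ambient_chart_def
    by (intro continuous_open_preimage) auto
  then show ?thesis
    using assms unfolding ambient_chart_def by (auto intro: Dk_subset)
qed

abbreviation (input) usphere :: "(real^'m::finite) set" where
  "usphere \<equiv> sphere 0 1"

definition stereo_domain :: "real \<Rightarrow> (real^('n::finite option)) set" where
  "stereo_domain \<sigma> = {p. \<sigma> * p $ None \<noteq> - 1}"

lemma ambient_chart_stereo:
  assumes "\<sigma> = 1 \<or> \<sigma> = - 1"
  shows "ambient_chart usphere (stereo_domain \<sigma>) (stereo \<sigma> :: real^('n::finite option) \<Rightarrow> _) UNIV (stereo_inv \<sigma>)"
proof -
  have "\<sigma> * stereo_inv \<sigma> x $ None \<noteq> - 1" for x :: "real^'n"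
    using stereo_inv_None_pos[OF assms, of x] one_plus_inner_pos[of x] by auto
  then show ?thesis
    by (simp add: ambient_chart_def stereo_domain_def open_stereo_domain Dk_stereo Dk_stereo_inv
        stereo_inv_stereo[OF assms] stereo_stereo_inv[OF assms] norm_stereo_inv[OF assms])
qed

definition sphere_atlas :: "((real^('n::finite option)) set \<times> (real^('n option) \<Rightarrow> real^'n)) set" where
  "sphere_atlas = (\<lambda>\<sigma>. (usphere \<inter> stereo_domain \<sigma>, stereo \<sigma>)) ` {1, - 1}"

lemma sphere_atlas_cases:
  assumes "(U, \<phi>) \<in> sphere_atlas"
  obtains \<sigma> where "\<sigma> = 1 \<or> \<sigma> = - 1" "U = usphere \<inter> stereo_domain \<sigma>" "\<phi> = stereo \<sigma>"
  using assms by (auto simp: sphere_atlas_def)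

lemma compatible_chart_sphere:
  assumes "ambient_chart usphere D \<theta> V \<psi>"
  shows "compatible_chart (top_of_set usphere) sphere_atlas (usphere \<inter> D) \<theta>"
  unfolding compatible_chart_def
  by (auto elim!: sphere_atlas_cases simp: ambient_chart_is_chart[OF assms]
      ambient_chart_smooth_compat[OF ambient_chart_stereo assms])

lemma jacobian_det_eq:
  "(f has_derivative f') (at x) \<Longrightarrow> jacobian_det f x = det (matrix f')"
  by (simp add: jacobian_det_def matrix_def dpart_eq)

text \<open>The derivative in the hypothesis is that of \<open>x \<mapsto> reflect (- 1) x /\<^sub>R (x \<bullet> x)\<close>.\<close>

lemma jacobian_det_inversion_pos:
  fixes x :: "real^'n::finite"
  assumes "x \<noteq> 0" and f: "(f has_derivative
    (\<lambda>v. (1 / (x \<bullet> x)) *\<^sub>R reflect (- 1) v - (2 * (x \<bullet> v) / (x \<bullet> x)\<^sup>2) *\<^sub>R reflect (- 1) x)) (at x)"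
  shows "jacobian_det f x > 0"
proof -
  define u where "u = x /\<^sub>R norm x"
  define R where "R = matrix (reflect (- 1) :: real^'n \<Rightarrow> real^'n)"
  define S where "S = (mat (1 / norm x) :: real^'n^'n)"
  obtain Q :: "real^'n^'n" where Q: "orthogonal_matrix Q" "Q *v (axis undefined 1) = u"
    using orthogonal_matrix_exists_basis[of u] assms by (auto simp: u_def)
  have R: "R *v w = reflect (- 1) w" for w
    unfolding R_def by (rule matrix_works) (simp add: linear_reflect linear_matrix_vector_mul_eq)
  \<comment> \<open>the Jacobian of the inversion is, up to a positive factor, the reflection along \<open>u\<close>, a conjugate of \<open>R\<close>;
    hence the determinant below is a square\<close>
  have RQ: "Q *v (R *v (transpose Q *v v)) = v - (2 * (v \<bullet> u)) *\<^sub>R u" for v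
  proof -
    have "(transpose Q *v v) $ undefined = (transpose Q *v v) \<bullet> axis undefined 1"
      by (simp add: inner_axis)
    also have "\<dots> = v \<bullet> u" using Q(2) by (simp add: dot_lmul_matrix)
    finally have *: "(transpose Q *v v) $ undefined = v \<bullet> u" .
    have "reflect (- 1) w = w - (2 * w $ undefined) *\<^sub>R axis undefined 1" for w :: "real^'n"
      by (auto simp: reflect_def vec_eq_iff axis_def)
    then have "Q *v (R *v (transpose Q *v v)) = Q *v (transpose Q *v v) - (2 * (v \<bullet> u)) *\<^sub>R u"
      by (simp add: R * matrix_vector_mult_diff_distrib matrix_vector_mult_scaleR Q(2)
          del: transpose_matrix_vector)
    then show ?thesis
      using Q(1) by (simp add: matrix_vector_mul_assoc orthogonal_matrix_def
          del: transpose_matrix_vector)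
  qed
  have S: "S *v v = (1 / norm x) *\<^sub>R v" for v
    by (simp add: S_def mat_def matrix_vector_mult_def vec_eq_iff if_distrib[of "\<lambda>a. a * _"] cong: if_cong)
  have "(S ** S ** R ** Q ** R ** transpose Q) *v v =
    (1 / (x \<bullet> x)) *\<^sub>R reflect (- 1) v - (2 * (x \<bullet> v) / (x \<bullet> x)\<^sup>2) *\<^sub>R reflect (- 1) x" for v
  proof -
    have "(S ** S ** R ** Q ** R ** transpose Q) *v v = S *v (S *v (R *v (Q *v (R *v (transpose Q *v v)))))"
      by (simp only: matrix_vector_mul_assoc matrix_mul_assoc)
    also have "\<dots> = (1 / (x \<bullet> x)) *\<^sub>R (reflect (- 1) v - (2 * (v \<bullet> u)) *\<^sub>R reflect (- 1) u)"
      unfolding RQ by (simp add: S R linear_diff[OF linear_reflect] reflect_scaleR dot_square_norm power2_eq_square)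
    finally show ?thesis
      by (simp add: u_def reflect_scaleR dot_square_norm power2_eq_square inner_commute scaleR_diff_right divide_inverse mult_ac)
  qed
  then have "matrix (\<lambda>v. (1 / (x \<bullet> x)) *\<^sub>R reflect (- 1) v - (2 * (x \<bullet> v) / (x \<bullet> x)\<^sup>2) *\<^sub>R reflect (- 1) x) =
    S ** S ** R ** Q ** R ** transpose Q"
    by (metis (no_types, lifting) ext matrix_of_matrix_vector_mul)
  then have "jacobian_det f x = (det S * det R * det Q)\<^sup>2"
    using jacobian_det_eq[OF f] by (simp add: det_mul power2_eq_square mult_ac)
  moreover have "det S \<noteq> 0"
    using assms(1) by (simp add: S_def det_diagonal mat_def)
  moreover have "det R \<noteq> 0"
    unfolding R_def det_nz_iff_inj[OF linear_reflect]
    by (metis injI reflect_reflect)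
  moreover have "det Q \<noteq> 0" using det_orthogonal_matrix[OF Q(1)] by auto
  ultimately show ?thesis by simp
qed

text \<open>The scalar factors combine to the inversion in the unit sphere. Exactly one of the two
  charts reflects, and this reflection makes the orientation-reversing inversion
  orientation-preserving.\<close>

lemma stereo_transition:
  assumes "\<sigma> = 1 \<or> \<sigma> = - 1" "x \<noteq> 0"
  shows "stereo (- \<sigma>) (stereo_inv \<sigma> x) = (1 / (x \<bullet> x)) *\<^sub>R reflect (- 1) x"
proof -
  define r where "r = x \<bullet> x"
  have r: "r > 0" using assms by (simp add: r_def)
  have "\<sigma> * \<sigma> = 1" using assms by auto
  then have "1 + - \<sigma> * stereo_inv \<sigma> x $ None = 2 * r / (1 + r)"
    using r by (simp add: stereo_inv_None r_def[symmetric] mult.assoc[symmetric] divide_simps)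
  moreover have "reflect (- \<sigma>) (reflect \<sigma> x) = reflect (- 1) x"
    using assms by (auto simp: reflect_def vec_eq_iff)
  moreover have "1 / (2 * r / (1 + r)) * (2 / (1 + r)) = 1 / r" using r by (simp add: divide_simps)
  ultimately show ?thesis
    unfolding stereo_def stereo_inv_Some r_def[symmetric] reflect_scaleR scaleR_scaleR by simp
qed

lemma closed_oriented_manifold_sphere:
  "closed_oriented_manifold (top_of_set (usphere :: (real^('n::finite option)) set)) sphere_atlas"
  unfolding closed_oriented_manifold_def
proof (intro conjI)
  show "topspace (top_of_set (usphere :: (real^('n option)) set)) \<noteq> {}" by simp
  show "Hausdorff_space (top_of_set (usphere :: (real^('n option)) set))"
    by (simp add: Hausdorff_space_subtopology)
  show "compact_space (top_of_set (usphere :: (real^('n option)) set))"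
    by (simp add: compact_space_subtopology)
  \<comment> \<open>Connectedness needs ambient dimension at least two, which holds because
    \<open>'n\<close> is nonempty and \<open>option\<close> adds an element.\<close>
  show "connected_space (top_of_set (usphere :: (real^('n option)) set))"
    by (simp add: connected_space_subtopology connected_sphere)
  show "\<forall>(U, \<phi>)\<in>(sphere_atlas :: (_ \<times> (real^('n option) \<Rightarrow> _)) set). is_chart (top_of_set usphere) U \<phi>"
    by (auto elim!: sphere_atlas_cases simp: ambient_chart_is_chart[OF ambient_chart_stereo])
  show "\<Union> (fst ` (sphere_atlas :: (_ \<times> (real^('n option) \<Rightarrow> _)) set)) = topspace (top_of_set usphere)"
    by (auto simp: sphere_atlas_def stereo_domain_def)
  have "smooth_compat (usphere \<inter> stereo_domain \<sigma>) (stereo \<sigma> :: real^('n option) \<Rightarrow> _)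
        (usphere \<inter> stereo_domain \<tau>) (stereo \<tau>) \<and>
      (\<forall>x\<in>stereo \<sigma> ` ((usphere \<inter> stereo_domain \<sigma>) \<inter> (usphere \<inter> stereo_domain \<tau>)).
         jacobian_det (stereo \<tau> \<circ> inv_into (usphere \<inter> stereo_domain \<sigma>) (stereo \<sigma>)) (x :: real^'n) > 0)"
    if \<sigma>: "\<sigma> = 1 \<or> \<sigma> = - 1" and \<tau>: "\<tau> = 1 \<or> \<tau> = - 1" for \<sigma> \<tau> :: real
  proof (intro conjI ballI)
    note A1 = ambient_chart_stereo[OF \<sigma>] and A2 = ambient_chart_stereo[OF \<tau>]
    show "smooth_compat (usphere \<inter> stereo_domain \<sigma>) (stereo \<sigma> :: real^('n option) \<Rightarrow> _) (usphere \<inter> stereo_domain \<tau>) (stereo \<tau>)"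
      by (rule ambient_chart_smooth_compat[OF A1 A2])
    fix x :: "real^'n"
    assume "x \<in> stereo \<sigma> ` ((usphere \<inter> stereo_domain \<sigma>) \<inter> (usphere \<inter> stereo_domain \<tau>))"
    then have x: "stereo_inv \<sigma> x \<in> stereo_domain \<tau>"
      unfolding ambient_chart_transition(1)[OF A1 A2] by simp
    have eq: "stereo \<tau> \<circ> inv_into (usphere \<inter> stereo_domain \<sigma>) (stereo \<sigma>) = (\<lambda>x. stereo \<tau> (stereo_inv \<sigma> x))"
      by (auto simp: ambient_chart_inv_into[OF A1])
    show "jacobian_det (stereo \<tau> \<circ> inv_into (usphere \<inter> stereo_domain \<sigma>) (stereo \<sigma>)) x > 0"
    proof (cases "\<sigma> = \<tau>")
      case True
      then have id: "stereo \<tau> \<circ> inv_into (usphere \<inter> stereo_domain \<sigma>) (stereo \<sigma>) = (\<lambda>x :: real^'n. x)"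
        unfolding eq by (simp add: stereo_stereo_inv[OF \<tau>])
      have "det (matrix (id :: real^'n \<Rightarrow> real^'n)) = 1" by (rule matrix_id)
      then show ?thesis
        unfolding id jacobian_det_eq[OF has_derivative_ident] by (simp add: id_def)
    next
      case False
      then have \<tau>\<sigma>: "\<tau> = - \<sigma>" using \<sigma> \<tau> by auto
      \<comment> \<open>The origin corresponds to the pole of height
        \<open>\<sigma> = - \<tau>\<close>, the one point missing from the domain of the other
        chart.\<close>
      have "x \<noteq> 0"
        using x \<sigma> by (auto simp: stereo_domain_def stereo_inv_None \<tau>\<sigma>)
      have "((\<lambda>x. inverse (x \<bullet> x) *\<^sub>R reflect (- 1) x) has_derivative
        (\<lambda>v. (1 / (x \<bullet> x)) *\<^sub>R reflect (- 1) v - (2 * (x \<bullet> v) / (x \<bullet> x)\<^sup>2) *\<^sub>R reflect (- 1) x)) (at x)"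
        using \<open>x \<noteq> 0\<close>
        by (auto intro!: derivative_eq_intros linear_imp_has_derivative[OF linear_reflect]
            simp: inner_commute power2_eq_square divide_inverse)
      then have "((\<lambda>x. stereo \<tau> (stereo_inv \<sigma> x)) has_derivative
        (\<lambda>v. (1 / (x \<bullet> x)) *\<^sub>R reflect (- 1) v - (2 * (x \<bullet> v) / (x \<bullet> x)\<^sup>2) *\<^sub>R reflect (- 1) x)) (at x)"
        by (rule has_derivative_transform_within_open[of _ _ _ _ "- {0}"])
          (use \<open>x \<noteq> 0\<close> in \<open>auto simp: \<tau>\<sigma> stereo_transition[OF \<sigma>] divide_inverse\<close>)
      then show ?thesis unfolding eq by (rule jacobian_det_inversion_pos[OF \<open>x \<noteq> 0\<close>])
    qed
  qed
  then show "\<forall>(U, \<phi>)\<in>(sphere_atlas :: (_ \<times> (real^('n option) \<Rightarrow> _)) set). \<forall>(V, \<psi>)\<in>sphere_atlas.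
      smooth_compat U \<phi> V \<psi> \<and> (\<forall>x\<in>\<phi> ` (U \<inter> V). jacobian_det (\<psi> \<circ> inv_into U \<phi>) x > 0)"
    by (simp add: sphere_atlas_def)
qed

subsection \<open>Hemispheres\<close>

definition hemisphere :: "real \<Rightarrow> (real^('n::finite option)) set" where
  "hemisphere \<tau> = {p \<in> usphere. 0 \<le> \<tau> * p $ None}"

lemma closed_hemisphere: "closed (hemisphere \<tau>)"
proof -
  have "hemisphere \<tau> = usphere \<inter> {p :: real^('a option). 0 \<le> \<tau> * p $ None}"
    by (auto simp: hemisphere_def)
  then show ?thesis by (auto intro!: closed_Int closed_Collect_le continuous_intros)
qed

lemma hemisphere_interior:
  assumes \<tau>: "\<tau> = 1 \<or> \<tau> = - 1"
  shows "top_of_set usphere interior_of hemisphere \<tau> = {p \<in> usphere. 0 < \<tau> * (p :: real^('n::finite option)) $ None}"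
proof (intro equalityI subsetI)
  fix p :: "real^('n option)" assume p: "p \<in> {p \<in> usphere. 0 < \<tau> * p $ None}"
  have "openin (top_of_set usphere) {p \<in> usphere. 0 < \<tau> * (p :: real^('n option)) $ None}"
  proof -
    have "open {p :: real^('n option). 0 < \<tau> * p $ None}"
      by (intro open_Collect_less continuous_intros)
    from openin_open_Int[OF this, of usphere] show ?thesis
      by (simp add: Int_def conj_commute del: mem_sphere)
  qed
  moreover have "{p \<in> usphere. 0 < \<tau> * (p :: real^('n option)) $ None} \<subseteq> hemisphere \<tau>"
    by (auto simp: hemisphere_def)
  ultimately show "p \<in> top_of_set usphere interior_of hemisphere \<tau>"
    using p interior_of_maximal by blast
next
  fix p :: "real^('n option)" assume "p \<in> top_of_set usphere interior_of hemisphere \<tau>"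
  then obtain W where W: "open W" "p \<in> usphere \<inter> W" "usphere \<inter> W \<subseteq> hemisphere \<tau>"
    by (auto simp: interior_of_def openin_open)
  have "p $ None \<noteq> 0"
  proof
    assume p0: "p $ None = 0"
    \<comment> \<open>A great circle through the equator point \<open>p\<close>, heading for the
      pole of height \<open>- \<tau>\<close>: for small positive \<open>t\<close> it lies in the
      opposite open hemisphere, so no neighbourhood of \<open>p\<close> stays in
      \<open>hemisphere \<tau>\<close>.\<close>
    define q where "q t = cos t *\<^sub>R p - (\<tau> * sin t) *\<^sub>R axis None 1" for t :: real
    have "p \<bullet> p = 1" using W(2) by (simp add: norm_eq_1)
    moreover have "axis None 1 \<bullet> (axis None 1 :: real^('n option)) = 1" by (simp add: inner_axis_axis)
    ultimately have "q t \<bullet> q t = (cos t)\<^sup>2 + (\<tau> * sin t)\<^sup>2" for t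
      using p0 by (simp add: q_def inner_diff_left inner_diff_right inner_axis inner_axis' power2_eq_square)
    then have "norm (q t) = 1" for t using \<tau> by (auto simp: norm_eq_1)
    then have qs: "q t \<in> usphere" for t by simp
    have "isCont q 0" unfolding q_def by (intro continuous_intros)
    then have "(q \<longlongrightarrow> p) (at_right 0)"
      using filterlim_at_split[of q "nhds p" "0::real"] by (simp add: isCont_def q_def)
    then have "\<forall>\<^sub>F t in at_right 0. q t \<in> W"
      using W(1,2) by (intro topological_tendstoD) auto
    moreover have "\<forall>\<^sub>F t in at_right 0. 0 < t \<and> t < pi"
      using eventually_at_right_real[of 0 pi] by (auto elim: eventually_mono)
    ultimately have "\<forall>\<^sub>F t in at_right (0::real). False"
    proof eventually_elim
      case (elim t)
      then have "q t \<in> hemisphere \<tau>" using qs W(3) by blast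
      then have "0 \<le> - sin t" using p0 \<tau> by (auto simp: hemisphere_def q_def axis_def)
      with sin_gt_zero[of t] elim show ?case by simp
    qed
    then show False by simp
  qed
  moreover have "0 \<le> \<tau> * p $ None" using W by (auto simp: hemisphere_def)
  ultimately show "p \<in> {p \<in> usphere. 0 < \<tau> * p $ None}"
    using W(2) \<tau> by auto
qed

lemma hemisphere_mbdry:
  assumes "\<tau> = 1 \<or> \<tau> = - 1"
  shows "mbdry (top_of_set usphere) (hemisphere \<tau>) = {p \<in> usphere. (p :: real^('n::finite option)) $ None = 0}"
  unfolding mbdry_def hemisphere_interior[OF assms] using assms by (auto simp: hemisphere_def)

lemma hemisphere_stereo_domain:
  assumes "\<tau> = 1 \<or> \<tau> = - 1" "p \<in> hemisphere \<tau>"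
  shows "p \<in> usphere \<inter> stereo_domain \<tau>"
  using assms by (auto simp: hemisphere_def stereo_domain_def)

text \<open>The height in direction \<open>\<tau>\<close> is
  \<open>(1 - x \<bullet> x) / (1 + x \<bullet> x)\<close>, which is nonnegative exactly on the unit
  ball. Connectedness of the hemisphere follows, as the image of a convex set.\<close>

lemma hemisphere_image_cball:
  assumes \<tau>: "\<tau> = 1 \<or> \<tau> = - 1"
  shows "hemisphere \<tau> = stereo_inv \<tau> ` cball (0 :: real^'n::finite) 1"
proof -
  have *: "0 \<le> \<tau> * stereo_inv \<tau> x $ None \<longleftrightarrow> x \<in> cball 0 1" for x :: "real^'n"
  proof -
    have "\<tau> * stereo_inv \<tau> x $ None = (1 - x \<bullet> x) / (1 + x \<bullet> x)"
      using \<tau> by (auto simp: stereo_inv_None)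
    then have "0 \<le> \<tau> * stereo_inv \<tau> x $ None \<longleftrightarrow> x \<bullet> x \<le> 1"
      using one_plus_inner_pos[of x] by (simp add: zero_le_divide_iff)
    then show ?thesis by (simp add: dot_square_norm abs_square_le_1)
  qed
  have "p \<in> stereo_inv \<tau> ` cball 0 1" if "p \<in> hemisphere \<tau>" for p :: "real^('n option)"
  proof -
    have "p = stereo_inv \<tau> (stereo \<tau> p)"
      using that stereo_inv_stereo[OF \<tau>, of p] \<tau> by (auto simp: hemisphere_def)
    moreover have "stereo \<tau> p \<in> cball 0 1"
      using that \<open>p = _\<close> * unfolding hemisphere_def by (metis mem_Collect_eq)
    ultimately show ?thesis by blast
  qed
  then show ?thesis using * by (auto simp: hemisphere_def norm_stereo_inv[OF \<tau>])
qed

lemma connected_hemisphere: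
  assumes "\<tau> = 1 \<or> \<tau> = - 1"
  shows "connected (hemisphere \<tau> :: (real^('n::finite option)) set)"
  unfolding hemisphere_image_cball[OF assms]
  by (intro connected_continuous_image Dk_continuous[OF Dk_stereo_inv] convex_connected convex_cball)

text \<open>Near an equator point whose coordinate \<open>Some k\<close> is nonzero, the sphere is a
  graph over the remaining coordinates. The height fills the vacant slot \<open>k\<close>, with sign
  \<open>- \<tau>\<close> so that the hemisphere becomes \<open>{x. x $ k \<le> 0}\<close>, the form
  that \<open>regular_domain\<close> asks for.\<close>

definition graph_chart :: "real \<Rightarrow> 'n \<Rightarrow> real^('n::finite option) \<Rightarrow> real^'n" where
  "graph_chart \<tau> k p = (\<chi> j. if j = k then - \<tau> * p $ None else p $ Some j)"

definition graph_param :: "real \<Rightarrow> real \<Rightarrow> 'n \<Rightarrow> real^'n::finite \<Rightarrow> real^('n option)" where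
  "graph_param \<tau> \<rho> k y = (\<chi> a. case a of None \<Rightarrow> - \<tau> * y $ k
     | Some j \<Rightarrow> if j = k then \<rho> * sqrt (1 - y \<bullet> y) else y $ j)"

lemma inner_replace_coordinate:
  fixes y :: "real^'n::finite"
  shows "(\<chi> j. if j = k then c else y $ j) \<bullet> (\<chi> j. if j = k then c else y $ j) = y \<bullet> y - (y $ k)\<^sup>2 + c\<^sup>2"
  by (simp add: inner_vec_def sum.remove[of UNIV k] power2_eq_square)

lemma ambient_chart_graph:
  fixes k :: "'n::finite"
  assumes \<tau>: "\<tau> = 1 \<or> \<tau> = - 1" and \<rho>: "\<rho> = 1 \<or> \<rho> = - 1"
  shows "ambient_chart usphere {p. 0 < \<rho> * p $ Some k} (graph_chart \<tau> k) {y. y \<bullet> y < 1} (graph_param \<tau> \<rho> k)"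
  unfolding ambient_chart_def
proof (intro conjI allI ballI)
  show "open {p :: real^('n option). 0 < \<rho> * p $ Some k}" "open {y :: real^'n. y \<bullet> y < 1}"
    by (auto intro!: open_Collect_less continuous_intros)
  fix m
  have "Dk m {p :: real^('n option). 0 < \<rho> * p $ Some k} (\<lambda>p. if j = k then - \<tau> * p $ None else p $ Some j)" for j
    by (cases "j = k") (auto intro!: Dk_mult Dk_const Dk_uminus Dk_vec_nth Dk_id)
  then show "Dk m {p. 0 < \<rho> * p $ Some k} (graph_chart \<tau> k)"
    unfolding graph_chart_def[abs_def] by (intro Dk_vec_lambda)
  have "Dk m {y :: real^'n. y \<bullet> y < 1} (\<lambda>y. case a of None \<Rightarrow> - \<tau> * y $ k
     | Some j \<Rightarrow> if j = k then \<rho> * sqrt (1 - y \<bullet> y) else y $ j)" for a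
  proof (cases a)
    case (Some j)
    then show ?thesis
      by (cases "j = k") (auto intro!: Dk_mult Dk_sqrt Dk_diff Dk_inner Dk_const Dk_vec_nth Dk_id)
  qed (auto intro!: Dk_mult Dk_const Dk_uminus Dk_vec_nth Dk_id)
  then show "Dk m {y. y \<bullet> y < 1} (graph_param \<tau> \<rho> k)"
    unfolding graph_param_def[abs_def] by (intro Dk_vec_lambda)
next
  have \<tau>2: "\<tau>\<^sup>2 = 1" and \<rho>2: "\<rho>\<^sup>2 = 1" using \<tau> \<rho> by auto
  {
    fix p :: "real^('n option)" assume p: "p \<in> usphere \<inter> {p. 0 < \<rho> * p $ Some k}"
    have "(p $ None)\<^sup>2 + (\<chi> k. p $ Some k) \<bullet> (\<chi> k. p $ Some k) = 1"
      using p inner_option[of p p] by (simp add: norm_eq_1 power2_eq_square)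
    moreover have "graph_chart \<tau> k p = (\<chi> j. if j = k then - \<tau> * p $ None else (\<chi> k. p $ Some k) $ j)"
      by (simp add: graph_chart_def cong: if_cong)
    ultimately have r: "1 - graph_chart \<tau> k p \<bullet> graph_chart \<tau> k p = (p $ Some k)\<^sup>2"
      unfolding inner_replace_coordinate by (simp add: inner_replace_coordinate power_mult_distrib \<tau>2)
    have "p $ Some k \<noteq> 0" using p by auto
    with r have "0 < 1 - graph_chart \<tau> k p \<bullet> graph_chart \<tau> k p" by simp
    then show "graph_chart \<tau> k p \<in> {y. y \<bullet> y < 1}" by simp
    have "\<rho> * \<bar>p $ Some k\<bar> = p $ Some k" using p \<rho> by auto
    moreover have "\<tau> * (\<tau> * p $ None) = p $ None" using \<tau> by auto
    moreover have "graph_chart \<tau> k p $ j = (if j = k then - \<tau> * p $ None else p $ Some j)" for j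
      by (simp add: graph_chart_def)
    ultimately show "graph_param \<tau> \<rho> k (graph_chart \<tau> k p) = p"
      by (auto simp: graph_param_def r vec_eq_iff split: option.split)
  next
    fix y :: "real^'n" assume y: "y \<in> {y. y \<bullet> y < 1}"
    have "graph_param \<tau> \<rho> k y \<bullet> graph_param \<tau> \<rho> k y = 1"
      using y unfolding inner_option[of "graph_param \<tau> \<rho> k y"]
      by (simp add: graph_param_def inner_replace_coordinate power_mult_distrib \<rho>2)
        (use \<tau> in \<open>auto simp: power2_eq_square\<close>)
    moreover have "0 < \<rho> * graph_param \<tau> \<rho> k y $ Some k"
      using \<rho> y by (auto simp: graph_param_def)
    ultimately show "graph_param \<tau> \<rho> k y \<in> usphere \<inter> {p. 0 < \<rho> * p $ Some k}"
      by (simp add: norm_eq_1)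
    show "graph_chart \<tau> k (graph_param \<tau> \<rho> k y) = y"
      using \<tau> by (auto simp: graph_param_def vec_eq_iff graph_chart_def)
  }
qed

lemma regular_domain_hemisphere:
  assumes \<tau>: "\<tau> = 1 \<or> \<tau> = - 1"
  shows "regular_domain (top_of_set usphere) sphere_atlas (hemisphere \<tau> :: (real^('n::finite option)) set)"
  unfolding regular_domain_def
proof (intro conjI ballI)
  show "closedin (top_of_set usphere) (hemisphere \<tau> :: (real^('n option)) set)"
    by (rule closed_subset[OF _ closed_hemisphere]) (auto simp: hemisphere_def)
  fix p :: "real^('n option)" assume p: "p \<in> hemisphere \<tau>"
  show "\<exists>W \<theta>. compatible_chart (top_of_set usphere) sphere_atlas W \<theta> \<and> p \<in> W \<and>
        (\<theta> ` (W \<inter> hemisphere \<tau>) = \<theta> ` W \<or>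
         (\<exists>k. \<theta> p $ k = 0 \<and> \<theta> ` (W \<inter> hemisphere \<tau>) = \<theta> ` W \<inter> {x. x $ k \<le> 0}))"
  proof (cases "p $ None = 0")
    case False
    \<comment> \<open>Away from the equator the chart is cut down to the open hemisphere, so that
      all of it lies in the domain and the first alternative holds.\<close>
    let ?D = "{p :: real^('n option). 0 < \<tau> * p $ None}"
    have "open ?D" by (intro open_Collect_less continuous_intros)
    then have "compatible_chart (top_of_set usphere) sphere_atlas (usphere \<inter> ?D) (stereo \<tau>)"
      by (rule compatible_chart_sphere[OF ambient_chart_restrict[OF ambient_chart_stereo[OF \<tau>]]])
        (auto simp: stereo_domain_def)
    moreover have "p \<in> usphere \<inter> ?D" using p False \<tau> by (auto simp: hemisphere_def)
    moreover have "(usphere \<inter> ?D) \<inter> hemisphere \<tau> = usphere \<inter> ?D" by (auto simp: hemisphere_def)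
    ultimately show ?thesis by metis
  next
    case True
    have "\<exists>k. p $ Some k \<noteq> 0"
    proof (rule ccontr)
      assume "\<not> (\<exists>k. p $ Some k \<noteq> 0)"
      then have "p = 0" using True by (intro vec_option_eqI) (auto simp: vec_eq_iff)
      with p show False by (simp add: hemisphere_def)
    qed
    then obtain k where k: "p $ Some k \<noteq> 0" by blast
    define \<rho> where "\<rho> = sgn (p $ Some k)"
    have \<rho>: "\<rho> = 1 \<or> \<rho> = - 1" using k by (auto simp: \<rho>_def sgn_if)
    let ?W = "usphere \<inter> {p :: real^('n option). 0 < \<rho> * p $ Some k}"
    have "compatible_chart (top_of_set usphere) sphere_atlas ?W (graph_chart \<tau> k)"
      by (rule compatible_chart_sphere[OF ambient_chart_graph[OF \<tau> \<rho>]])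
    moreover have "p \<in> ?W" using p k by (auto simp: hemisphere_def \<rho>_def sgn_if)
    moreover have "graph_chart \<tau> k p $ k = 0" using True by (simp add: graph_chart_def)
    moreover have "graph_chart \<tau> k ` (?W \<inter> hemisphere \<tau>) = graph_chart \<tau> k ` ?W \<inter> {x. x $ k \<le> 0}"
      by (auto simp: hemisphere_def graph_chart_def)
    ultimately show ?thesis by metis
  qed
qed

subsection \<open>The lens\<close>

text \<open>A Lorentz boost of the sphere: it maps the hemisphere \<open>hemisphere \<tau>\<close> onto the cap
  \<open>\<tau> * \<nu> $ None \<ge> 3/5\<close> and acts as a dilation in the stereographic charts.\<close>

definition cap_normal :: "real \<Rightarrow> real^('n::finite option) \<Rightarrow> real^('n option)" where
  "cap_normal \<tau> p = (1 / (5 + 3 * \<tau> * p $ None)) *\<^sub>R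
     (\<chi> a. case a of None \<Rightarrow> 5 * p $ None + 3 * \<tau> | Some k \<Rightarrow> 4 * p $ Some k)"

text \<open>One formula for both halves. On \<open>hemisphere \<tau>\<close>, with
  \<open>z = p $ None\<close>, one has \<open>\<bar>z\<bar> = \<tau> * z\<close>, and moving the cap
  down by \<open>3/5 * \<tau>\<close> changes the numerator \<open>5 * z + 3 * \<tau>\<close> into
  \<open>5 * z + 3 * \<tau> - 3/5 * \<tau> * (5 + 3 * \<tau> * z) = 16/5 * z\<close>.\<close>

definition lens :: "real^('n::finite option) \<Rightarrow> real^('n option)" where
  "lens p = (1 / (5 + 3 * \<bar>p $ None\<bar>)) *\<^sub>R
     (\<chi> a. case a of None \<Rightarrow> 16/5 * p $ None | Some k \<Rightarrow> 4 * p $ Some k)"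

text \<open>The factors are determined by the equator, the unit sphere in both charts: radius 1/2 in
  chart \<open>\<tau>\<close> and radius 2 in the opposite chart both describe the points of height
  \<open>3/5 * \<tau>\<close>, the rim of the cap.\<close>

lemma cap_normal_stereo_inv:
  fixes x :: "real^'n::finite"
  assumes \<sigma>: "\<sigma> = 1 \<or> \<sigma> = - 1" and \<tau>: "\<tau> = 1 \<or> \<tau> = - 1"
  shows "cap_normal \<tau> (stereo_inv \<sigma> x) = stereo_inv \<sigma> ((if \<sigma> = \<tau> then 1/2 else 2) *\<^sub>R x)"
proof -
  define r where "r = x \<bullet> x"
  have r: "0 \<le> r" "1 + r \<noteq> 0" "4 + r \<noteq> 0" "1 + 4 * r \<noteq> 0" by (auto simp: r_def add_nonneg_eq_0_iff)
  have \<sigma>\<sigma>: "\<sigma> * \<sigma> = 1" using \<sigma> by auto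
  show ?thesis
  proof (cases "\<sigma> = \<tau>")
    case True
    have z: "5 * stereo_inv \<sigma> x $ None + 3 * \<tau> = 2 * \<sigma> * (4 - r) / (1 + r)"
      "5 + 3 * \<tau> * stereo_inv \<sigma> x $ None = 2 * (4 + r) / (1 + r)"
      using r \<sigma> by (auto simp: True[symmetric] stereo_inv_None r_def[symmetric] divide_simps)
    show ?thesis
    proof (rule vec_option_eqI)
      show "cap_normal \<tau> (stereo_inv \<sigma> x) $ None = stereo_inv \<sigma> ((if \<sigma> = \<tau> then 1/2 else 2) *\<^sub>R x) $ None"
        using r unfolding cap_normal_def vector_scaleR_component vec_lambda_beta option.case z
        by (simp add: stereo_inv_None True r_def[symmetric] divide_simps)
      have "(\<chi> k. cap_normal \<tau> (stereo_inv \<sigma> x) $ Some k) =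
          (4 / (2 * (4 + r) / (1 + r))) *\<^sub>R (\<chi> k. stereo_inv \<sigma> x $ Some k)"
        by (simp add: cap_normal_def z vec_eq_iff)
      also have "\<dots> = (\<chi> k. stereo_inv \<sigma> ((1/2) *\<^sub>R x) $ Some k)"
      proof -
        have "4 / (2 * (4 + r) / (1 + r)) * (2 / (1 + r)) = 2 / (1 + r / 4) * (1 / 2)"
        proof -
          have *: "4 / (2 * t / s) * (2 / s) = 2 / (t / 4) * (1 / 2)" if "s \<noteq> 0" for s t :: real
            using that by simp
          have "1 + r / 4 = (4 + r) / 4" by simp
          then show ?thesis using *[OF r(2)] by (simp only:)
        qed
        moreover have "((1/2) *\<^sub>R x) \<bullet> ((1/2) *\<^sub>R x) = r / 4" by (simp add: r_def)
        ultimately show ?thesis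
          unfolding stereo_inv_Some r_def[symmetric] reflect_scaleR scaleR_scaleR by (simp only:)
      qed
      finally show "(\<chi> k. cap_normal \<tau> (stereo_inv \<sigma> x) $ Some k) =
          (\<chi> k. stereo_inv \<sigma> ((if \<sigma> = \<tau> then 1/2 else 2) *\<^sub>R x) $ Some k)"
        by (simp add: True)
    qed
  next
    case False
    then have \<tau>: "\<tau> = - \<sigma>" using \<sigma> \<tau> by auto
    have z: "5 * stereo_inv \<sigma> x $ None + 3 * \<tau> = 2 * \<sigma> * (1 - 4 * r) / (1 + r)"
      "5 + 3 * \<tau> * stereo_inv \<sigma> x $ None = 2 * (1 + 4 * r) / (1 + r)"
      using r \<sigma> by (auto simp: \<tau> stereo_inv_None r_def[symmetric] divide_simps)
    show ?thesis
    proof (rule vec_option_eqI)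
      show "cap_normal \<tau> (stereo_inv \<sigma> x) $ None = stereo_inv \<sigma> ((if \<sigma> = \<tau> then 1/2 else 2) *\<^sub>R x) $ None"
        using r unfolding cap_normal_def vector_scaleR_component vec_lambda_beta option.case z
        by (simp add: stereo_inv_None False r_def[symmetric] divide_simps)
      have "(\<chi> k. cap_normal \<tau> (stereo_inv \<sigma> x) $ Some k) =
          (4 / (2 * (1 + 4 * r) / (1 + r))) *\<^sub>R (\<chi> k. stereo_inv \<sigma> x $ Some k)"
        by (simp add: cap_normal_def z vec_eq_iff)
      also have "\<dots> = (\<chi> k. stereo_inv \<sigma> (2 *\<^sub>R x) $ Some k)"
      proof -
        have "4 / (2 * (1 + 4 * r) / (1 + r)) * (2 / (1 + r)) = 2 / (1 + 4 * r) * 2"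
        proof -
          have *: "4 / (2 * t / s) * (2 / s) = 2 / t * 2" if "s \<noteq> 0" for s t :: real
            using that by simp
          show ?thesis by (rule *[OF r(2)])
        qed
        moreover have "(2 *\<^sub>R x) \<bullet> (2 *\<^sub>R x) = 4 * r" by (simp add: r_def)
        ultimately show ?thesis
          unfolding stereo_inv_Some r_def[symmetric] reflect_scaleR scaleR_scaleR by (simp only:)
      qed
      finally show "(\<chi> k. cap_normal \<tau> (stereo_inv \<sigma> x) $ Some k) =
          (\<chi> k. stereo_inv \<sigma> ((if \<sigma> = \<tau> then 1/2 else 2) *\<^sub>R x) $ Some k)"
        by (simp add: False)
    qed
  qed
qed

lemma cap_normal_denominator_pos:
  fixes p :: "real^('n::finite option)"
  assumes "\<tau> = 1 \<or> \<tau> = - 1" "norm p = 1"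
  shows "0 < 5 + 3 * \<tau> * p $ None"
  using assms component_le_norm_cart[of p None] by auto

lemma norm_cap_normal:
  fixes p :: "real^('n::finite option)"
  assumes \<tau>: "\<tau> = 1 \<or> \<tau> = - 1" and p: "p \<in> hemisphere \<tau>"
  shows "norm (cap_normal \<tau> p) = 1"
proof -
  have "stereo_inv \<tau> (stereo \<tau> p) = p"
    using p hemisphere_stereo_domain[OF \<tau> p] by (intro stereo_inv_stereo \<tau>) (auto simp: stereo_domain_def)
  then show ?thesis using cap_normal_stereo_inv[OF \<tau> \<tau>, of "stereo \<tau> p"] norm_stereo_inv[OF \<tau>] by metis
qed

lemma lens_eq_cap_normal:
  fixes p :: "real^('n::finite option)"
  assumes \<tau>: "\<tau> = 1 \<or> \<tau> = - 1" and p: "p \<in> hemisphere \<tau>"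
  shows "lens p = cap_normal \<tau> p - (3/5 * \<tau>) *\<^sub>R axis None 1"
proof -
  define d where "d = 5 + 3 * \<tau> * p $ None"
  have d: "d > 0" and abs: "\<bar>p $ None\<bar> = \<tau> * p $ None"
    using p \<tau> cap_normal_denominator_pos[OF \<tau>, of p] by (auto simp: hemisphere_def d_def)
  have "16/5 * p $ None = 5 * p $ None + 3 * \<tau> - 3/5 * \<tau> * d"
    using \<tau> by (auto simp: d_def)
  then have "16/5 * p $ None / d = (5 * p $ None + 3 * \<tau>) / d - 3/5 * \<tau>"
    using d by (simp only: diff_divide_distrib) simp
  moreover have "5 + 3 * \<bar>p $ None\<bar> = d" by (simp add: abs d_def)
  ultimately show ?thesis
    by (auto simp: vec_eq_iff lens_def cap_normal_def d_def[symmetric] axis_def split: option.split)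
qed

text \<open>For \<open>z \<ge> 0\<close> the height \<open>(5 * z + 3) / (5 + 3 * z)\<close> is at
  least 3/5, hence strictly above the threshold 1/2. The equator is included, so both one-sided
  fields are known on the edge.\<close>

lemma cahn_hoffman_cap_normal:
  fixes p :: "real^('n::finite option)"
  assumes \<tau>: "\<tau> = 1 \<or> \<tau> = - 1" and p: "p \<in> hemisphere \<tau>"
  shows "cahn_hoffman lens_integrand (cap_normal \<tau> p) = lens p"
  unfolding lens_eq_cap_normal[OF assms]
proof (rule cahn_hoffman_lens[OF \<tau> norm_cap_normal[OF assms]])
  have "0 \<le> \<tau> * p $ None" using p by (simp add: hemisphere_def)
  moreover have "\<tau> * cap_normal \<tau> p $ None = (5 * (\<tau> * p $ None) + 3) / (5 + 3 * (\<tau> * p $ None))"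
    using \<tau> by (auto simp: cap_normal_def)
  moreover have "1/2 < (5 * z + 3) / (5 + 3 * z)" if "0 \<le> z" for z :: real
    using that by (simp add: field_simps)
  ultimately show "1/2 < \<tau> * cap_normal \<tau> p $ None" by metis
qed

text \<open>A Cahn--Hoffman field that coincides with the immersion has the same differential, so
  \<open>B = - G\<close> and the shape operator is minus the identity. What remains is invertibility
  of the Gram matrix: \<open>G *v c = 0\<close> makes the corresponding tangent vector orthogonal to
  itself, and the immersion condition in \<open>reg\<close> gives \<open>c = 0\<close>.\<close>

lemma aniso_mc_cahn_hoffman_image:
  fixes Y :: "real^'n::finite \<Rightarrow> real^('n option)"
  assumes reg: "pos_normal_at TYPE('n) Y x \<nu>" and Y: "(Y has_derivative Y') (at x)"
    and W: "open W" "x \<in> W" "\<And>y. y \<in> W \<Longrightarrow> cahn_hoffman \<gamma> (Nc y) = Y y"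
  shows "aniso_mc \<gamma> Y Nc x = - 1"
proof -
  define G :: "real^'n^'n" where "G = (\<chi> j l. Y' (axis j 1) \<bullet> Y' (axis l 1))"
  have Y_part: "dpart v Y x = Y' v" for v by (rule dpart_eq[OF Y])
  have "((\<lambda>y. cahn_hoffman \<gamma> (Nc y)) has_derivative Y') (at x)"
    by (rule has_derivative_transform_within_open[OF Y W(1,2)]) (simp add: W(3))
  then have "dpart v (\<lambda>y. cahn_hoffman \<gamma> (Nc y)) x = Y' v" for v by (rule dpart_eq)
  moreover have "(\<chi> j l. - Y' (axis j 1) \<bullet> Y' (axis l 1)) = - G"
    by (simp add: G_def vec_eq_iff)
  ultimately have mc: "aniso_mc \<gamma> Y Nc x = (1 / real CARD('n)) * trace (- G ** matrix_inv G)"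
    unfolding aniso_mc_def Let_def by (simp add: Y_part G_def[symmetric])
  have "c = 0" if "G *v c = 0" for c
  proof -
    define w where "w = (\<Sum>j\<in>UNIV. c $ j *\<^sub>R Y' (axis j 1))"
    have "Y' (axis j 1) \<bullet> w = (G *v c) $ j" for j
      unfolding w_def G_def matrix_vector_mult_def by (simp add: inner_sum_right mult.commute)
    then have "Y' (axis j 1) \<bullet> w = 0" for j using that by simp
    moreover have "w \<bullet> w = (\<Sum>j\<in>UNIV. c $ j * (Y' (axis j 1) \<bullet> w))"
      unfolding w_def inner_sum_left[of _ _ "sum _ _"] by simp
    ultimately have "w \<bullet> w = 0" by simp
    then have "(\<Sum>j\<in>UNIV. c $ j *\<^sub>R dpart (axis j 1) Y x) = 0" by (simp add: Y_part w_def)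
    then have "\<forall>j. c $ j = 0" using reg unfolding pos_normal_at_def by blast
    then show "c = 0" by (simp add: vec_eq_iff)
  qed
  then have "invertible G" using matrix_left_invertible_ker invertible_left_inverse by blast
  then have "G ** matrix_inv G = mat 1"
    unfolding matrix_inv_def invertible_def by (rule someI2_ex) blast
  moreover have "- G ** H = - (G ** H)" for H
    by (simp add: vec_eq_iff matrix_matrix_mult_def sum_negf)
  ultimately have "- G ** matrix_inv G = - mat 1" by metis
  moreover have "trace (- mat 1 :: real^'n^'n) = - real CARD('n)"
    by (simp add: trace_def mat_def sum_negf)
  ultimately show ?thesis unfolding mc by simp
qed

lemma lens_in_stereo_chart:
  fixes x :: "real^'n::finite"
  assumes \<sigma>: "\<sigma> = 1 \<or> \<sigma> = - 1" and \<tau>: "\<tau> = 1 \<or> \<tau> = - 1" and p: "stereo_inv \<sigma> x \<in> hemisphere \<tau>"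
  shows "lens (stereo_inv \<sigma> x) =
    stereo_inv \<sigma> ((if \<sigma> = \<tau> then 1/2 else 2) *\<^sub>R x) - (3/5 * \<tau>) *\<^sub>R axis None 1"
  by (rule lens_eq_cap_normal[OF \<tau> p, unfolded cap_normal_stereo_inv[OF \<sigma> \<tau>]])

text \<open>The conditions range over all charts of the atlas, so each open hemisphere
  \<open>\<tau>\<close> is examined in both charts \<open>\<sigma>\<close>; only the dilation factor
  \<open>c\<close> depends on the combination.\<close>

lemma lens_regular_CAMC_point:
  fixes p :: "real^('n::finite option)"
  assumes \<sigma>: "\<sigma> = 1 \<or> \<sigma> = - 1" and \<tau>: "\<tau> = 1 \<or> \<tau> = - 1"
    and p: "p \<in> usphere" "0 < \<tau> * p $ None" "p \<in> stereo_domain \<sigma>"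
  defines "inv\<sigma> \<equiv> inv_into (usphere \<inter> stereo_domain \<sigma>) (stereo \<sigma> :: _ \<Rightarrow> real^'n)"
  shows "pos_normal_at TYPE('n) (lens \<circ> inv\<sigma>) (stereo \<sigma> p) (cap_normal \<tau> p)"
    and "aniso_mc lens_integrand (lens \<circ> inv\<sigma>) (cap_normal \<tau> \<circ> inv\<sigma>) (stereo \<sigma> p) = - 1"
proof -
  define c :: real where "c = (if \<sigma> = \<tau> then 1/2 else 2)"
  define Z :: "real^'n \<Rightarrow> _" where "Z x = stereo_inv \<sigma> (c *\<^sub>R x)" for x
  define x where "x = stereo \<sigma> p"
  define W where "W = {x :: real^'n. 0 < \<tau> * stereo_inv \<sigma> x $ None}"
  have inv: "inv\<sigma> y = stereo_inv \<sigma> y" for y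
    unfolding inv\<sigma>_def by (rule ambient_chart_inv_into[OF ambient_chart_stereo[OF \<sigma>]]) simp
  have px: "stereo_inv \<sigma> x = p"
    unfolding x_def using p by (intro stereo_inv_stereo[OF \<sigma>]) (auto simp: stereo_domain_def)
  have "continuous_on UNIV (stereo_inv \<sigma> :: real^'n \<Rightarrow> _)" by (rule Dk_continuous[OF Dk_stereo_inv])
  then have "open W" unfolding W_def by (intro open_Collect_less continuous_intros)
  have "x \<in> W" using p by (simp add: W_def px)
  have hemi: "stereo_inv \<sigma> y \<in> hemisphere \<tau>" if "y \<in> W" for y
    using that by (simp add: W_def hemisphere_def norm_stereo_inv[OF \<sigma>])
  have lensW: "(lens \<circ> inv\<sigma>) y = Z y - (3/5 * \<tau>) *\<^sub>R axis None 1" if "y \<in> W" for y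
    using lens_in_stereo_chart[OF \<sigma> \<tau> hemi[OF that]] by (simp add: inv Z_def c_def)
  have "Dk (Suc 0) UNIV Z"
    unfolding Z_def
    by (rule Dk_compose[OF Dk_stereo_inv[of _ UNIV] Dk_linear[OF bounded_linear_scaleR_right]]) simp
  then obtain Z' where Z': "(Z has_derivative Z') (at x)" by auto
  then have "((\<lambda>y. Z y - (3/5 * \<tau>) *\<^sub>R axis None 1) has_derivative Z') (at x)"
    by (auto intro!: derivative_eq_intros)
  then have Y': "(lens \<circ> inv\<sigma> has_derivative Z') (at x)"
    by (rule has_derivative_transform_within_open[OF _ \<open>open W\<close> \<open>x \<in> W\<close>]) (simp only: lensW)
  have N: "cap_normal \<tau> p = Z x"
    using cap_normal_stereo_inv[OF \<sigma> \<tau>, of x] by (simp add: px Z_def c_def)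
  have "pos_normal_at TYPE('n) Z x (Z x)"
    unfolding Z_def by (rule pos_normal_stereo_inv[OF \<sigma>]) (simp add: c_def)
  \<comment> \<open>\<open>pos_normal_at\<close> sees a map only through its partial derivatives,
    which the translation by a multiple of the axis leaves unchanged.\<close>
  then have reg: "pos_normal_at TYPE('n) (lens \<circ> inv\<sigma>) x (cap_normal \<tau> p)"
    unfolding pos_normal_at_def dpart_eq[OF Z'] dpart_eq[OF Y'] N .
  then show "pos_normal_at TYPE('n) (lens \<circ> inv\<sigma>) (stereo \<sigma> p) (cap_normal \<tau> p)" by (simp add: x_def)
  show "aniso_mc lens_integrand (lens \<circ> inv\<sigma>) (cap_normal \<tau> \<circ> inv\<sigma>) (stereo \<sigma> p) = - 1"
    unfolding x_def[symmetric]
  proof (rule aniso_mc_cahn_hoffman_image[OF reg Y' \<open>open W\<close> \<open>x \<in> W\<close>])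
    fix y assume "y \<in> W"
    then show "cahn_hoffman lens_integrand ((cap_normal \<tau> \<circ> inv\<sigma>) y) = (lens \<circ> inv\<sigma>) y"
      by (simp add: inv cahn_hoffman_cap_normal[OF \<tau> hemi])
  qed
qed

text \<open>The absolute value in \<open>lens\<close> is harmless on a single closed hemisphere:
  there the chart expression is the restriction of a map smooth on the whole coordinate space, which
  serves as the local extension at every point, the edge included.\<close>

lemma lens_Ck_on_hemisphere:
  fixes \<tau> :: real
  assumes \<sigma>: "\<sigma> = 1 \<or> \<sigma> = - 1" and \<tau>: "\<tau> = 1 \<or> \<tau> = - 1"
  defines "inv\<sigma> \<equiv> inv_into (usphere \<inter> stereo_domain \<sigma>) (stereo \<sigma> :: real^('n::finite option) \<Rightarrow> real^'n)"
  defines "S \<equiv> stereo \<sigma> ` ((usphere \<inter> stereo_domain \<sigma>) \<inter> hemisphere \<tau>)"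
  shows "Ck_on_set k S (lens \<circ> inv\<sigma>)" "Ck_on_set k S (cap_normal \<tau> \<circ> inv\<sigma>)"
proof -
  have inv: "inv\<sigma> y = stereo_inv \<sigma> y" for y
    unfolding inv\<sigma>_def by (rule ambient_chart_inv_into[OF ambient_chart_stereo[OF \<sigma>]]) simp
  have hemi: "stereo_inv \<sigma> y \<in> hemisphere \<tau>" if "y \<in> S" for y
    using that by (auto simp: S_def stereo_domain_def stereo_inv_stereo[OF \<sigma>])
  have Z: "Dk k UNIV (\<lambda>x :: real^'n. stereo_inv \<sigma> ((if \<sigma> = \<tau> then 1/2 else 2) *\<^sub>R x))"
    by (rule Dk_compose[OF Dk_stereo_inv[of _ UNIV] Dk_linear[OF bounded_linear_scaleR_right]]) simp
  show "Ck_on_set k S (lens \<circ> inv\<sigma>)"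
    by (rule Dk_imp_Ck_on_set[OF open_UNIV Dk_diff[OF Z Dk_const]])
      (auto simp: inv lens_in_stereo_chart[OF \<sigma> \<tau> hemi])
  show "Ck_on_set k S (cap_normal \<tau> \<circ> inv\<sigma>)"
    by (rule Dk_imp_Ck_on_set[OF open_UNIV Z]) (auto simp: inv cap_normal_stereo_inv[OF \<sigma> \<tau>])
qed

lemma continuous_lens: "continuous_on S lens"
proof -
  have "continuous_on S (\<lambda>p. case a of None \<Rightarrow> 16/5 * p $ None | Some k \<Rightarrow> 4 * p $ Some k)" for a
    by (cases a) (auto intro!: continuous_intros)
  moreover have "5 + 3 * \<bar>z\<bar> \<noteq> (0 :: real)" for z by arith
  ultimately show ?thesis
    unfolding lens_def[abs_def] by (intro continuous_intros ballI) auto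
qed

text \<open>Up to a positive factor, \<open>lens\<close> is an invertible diagonal linear map. Equal
  images therefore make \<open>p\<close> and \<open>q\<close> positive multiples of each other, and
  both have norm 1.\<close>

lemma inj_on_lens: "inj_on lens (usphere :: (real^('n::finite option)) set)"
proof (rule inj_onI)
  fix p q :: "real^('n option)"
  assume pq: "p \<in> usphere" "q \<in> usphere" "lens p = lens q"
  define s where "s = (5 + 3 * \<bar>p $ None\<bar>) / (5 + 3 * \<bar>q $ None\<bar>)"
  have s: "s > 0" by (simp add: s_def add_pos_nonneg)
  have nz: "5 + 3 * \<bar>z\<bar> \<noteq> (0 :: real)" for z by arith
  have "p $ a = s * q $ a" for a
    using arg_cong[OF pq(3), of "\<lambda>v. v $ a"] nz[of "p $ None"] nz[of "q $ None"]
    by (cases a) (simp_all add: lens_def s_def field_simps)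
  then have "p = s *\<^sub>R q" by (simp add: vec_eq_iff)
  moreover from this have "s = 1" using pq s by simp
  ultimately show "p = q" by simp
qed

section \<open>The lens as a closed CAMC hypersurface\<close>

definition piece_sign :: "nat \<Rightarrow> real" where
  "piece_sign i = (if i = 0 then 1 else - 1)"

lemma piece_sign_cases: "piece_sign i = 1 \<or> piece_sign i = - 1"
  by (simp add: piece_sign_def)

lemma closed_embedded_CAMC_lens:
  "closed_embedded_CAMC lens_integrand (top_of_set (usphere :: (real^('n::finite option)) set)) sphere_atlas
     2 (\<lambda>i. hemisphere (piece_sign i)) (\<lambda>i. cap_normal (piece_sign i)) lens"
  unfolding closed_embedded_CAMC_def
proof (intro conjI)
  let ?P = "\<lambda>i. hemisphere (piece_sign i) :: (real^('n option)) set"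
  let ?T = "top_of_set (usphere :: (real^('n option)) set)"
  have lt2: "i < 2 \<longleftrightarrow> i = 0 \<or> i = 1" for i :: nat by auto
  have equator: "?P i \<inter> ?P j = {p \<in> usphere. p $ None = 0}" if "i < 2" "j < 2" "i \<noteq> j" for i j
    using that by (auto simp: lt2 piece_sign_def hemisphere_def)
  have P_sub: "?P i \<subseteq> usphere" for i by (auto simp: hemisphere_def)
  have "compact (?P i)" for i
  proof -
    have "compact (usphere \<inter> ?P i)" by (intro compact_Int_closed compact_sphere closed_hemisphere)
    then show ?thesis by (simp only: Int_absorb1[OF P_sub])
  qed
  note P = this connected_hemisphere[OF piece_sign_cases] regular_domain_hemisphere[OF piece_sign_cases]
  show "piecewise_weak_immersion 2 ?T sphere_atlas 2 ?P (\<lambda>i. cap_normal (piece_sign i)) lens"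
    unfolding piecewise_weak_immersion_def
  proof (intro conjI)
    show "closed_oriented_manifold ?T sphere_atlas" by (rule closed_oriented_manifold_sphere)
    show "(\<Union>i<2. ?P i) = topspace ?T"
    proof -
      have "{..<2} = {0, 1 :: nat}" by auto
      moreover have "usphere \<subseteq> ?P 0 \<union> ?P 1"
        by (auto simp: hemisphere_def piece_sign_def)
      ultimately show ?thesis using P_sub[of 0] P_sub[of 1] by simp blast
    qed
    show "\<forall>i<2. regular_domain ?T sphere_atlas (?P i) \<and> compactin ?T (?P i) \<and> connectedin ?T (?P i)"
      using P P_sub by (auto simp: compactin_subtopology connectedin_subtopology)
    show "\<forall>i<2. \<forall>j<2. i \<noteq> j \<longrightarrow> ?P i \<inter> ?P j = mbdry ?T (?P i) \<inter> mbdry ?T (?P j)"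
      by (simp add: equator hemisphere_mbdry[OF piece_sign_cases])
    show "continuous_map ?T euclidean lens" by (simp add: continuous_lens)
    show "\<forall>i<2. \<forall>(U, \<phi>)\<in>sphere_atlas. Ck_on_set 2 (\<phi> ` (U \<inter> ?P i)) (lens \<circ> inv_into U \<phi>) \<and>
        Ck_on_set (2 - 1) (\<phi> ` (U \<inter> ?P i)) (cap_normal (piece_sign i) \<circ> inv_into U \<phi>)"
      by (auto elim!: sphere_atlas_cases simp: lens_Ck_on_hemisphere[OF _ piece_sign_cases])
    show "\<forall>i<2. \<forall>p\<in>?P i. norm (cap_normal (piece_sign i) p) = 1"
      by (simp add: norm_cap_normal[OF piece_sign_cases])
    show "\<forall>i<2. \<forall>p\<in>?T interior_of ?P i. \<forall>(U, \<phi>)\<in>sphere_atlas. p \<in> U \<longrightarrow>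
        pos_normal_at TYPE('n) (lens \<circ> inv_into U \<phi>) (\<phi> p) (cap_normal (piece_sign i) p)"
      unfolding hemisphere_interior[OF piece_sign_cases]
      by (auto elim!: sphere_atlas_cases simp: lens_regular_CAMC_point(1)[OF _ piece_sign_cases])
  qed simp
  show "inj_on lens (topspace ?T)" by (simp add: inj_on_lens)
  show "CAMC lens_integrand ?T sphere_atlas 2 ?P (\<lambda>i. cap_normal (piece_sign i)) lens"
    unfolding CAMC_def
  proof (intro conjI)
    show "\<exists>\<Lambda>. \<forall>i<2. \<forall>p\<in>?T interior_of ?P i. \<forall>(U, \<phi>)\<in>sphere_atlas. p \<in> U \<longrightarrow>
        aniso_mc lens_integrand (lens \<circ> inv_into U \<phi>) (cap_normal (piece_sign i) \<circ> inv_into U \<phi>) (\<phi> p) = \<Lambda>"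
      unfolding hemisphere_interior[OF piece_sign_cases]
      by (rule exI[of _ "- 1"])
        (auto elim!: sphere_atlas_cases simp: lens_regular_CAMC_point(2)[OF _ piece_sign_cases])
    \<comment> \<open>Both fields equal \<open>lens \<zeta>\<close>, so the difference is 0 and lies
      in the span of any set of tangent vectors.\<close>
    show "\<forall>i<2. \<forall>j<2. i \<noteq> j \<longrightarrow> (\<forall>\<zeta>\<in>?P i \<inter> ?P j.
        cahn_hoffman lens_integrand (cap_normal (piece_sign i) \<zeta>) -
        cahn_hoffman lens_integrand (cap_normal (piece_sign j) \<zeta>)
        \<in> span (tangent_vecs ?T sphere_atlas lens (?P i \<inter> ?P j) \<zeta>))"
      by (simp add: cahn_hoffman_cap_normal[OF piece_sign_cases] span_zero)
  qed
qed

theorem theorem1p1: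
  shows "\<exists>\<gamma> :: real^('n::finite option) \<Rightarrow> real.
     smooth_on_sphere \<gamma> \<and> (\<forall>\<nu>\<in>sphere 0 1. \<gamma> \<nu> > 0) \<and> \<not> convex_integrand \<gamma> \<and>
     (\<exists>(T :: (real^'n option) topology) (A :: ((real^'n option) set \<times> ((real^'n option) \<Rightarrow> real^'n)) set)
        k P N X.
        closed_embedded_CAMC \<gamma> T A k P N X \<and>
        (\<forall>a>0. \<forall>b. X ` topspace T \<noteq> (\<lambda>x. a *\<^sub>R x + b) ` wulff_shape \<gamma>))"
proof -
  have height: "\<bar>x $ None\<bar> \<le> 2/5" if x: "x \<in> lens ` (usphere :: (real^('n option)) set)" for x :: "real^('n option)"
  proof -
    obtain p :: "real^('n option)" where p: "norm p = 1" "x = lens p" using x by auto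
    then have "\<bar>p $ None\<bar> \<le> 1" using component_le_norm_cart[of p None] by simp
    moreover have "\<bar>x $ None\<bar> = 16/5 * \<bar>p $ None\<bar> / (5 + 3 * \<bar>p $ None\<bar>)"
      by (simp add: p lens_def abs_mult)
    \<comment> \<open>The left-hand side increases with \<open>t\<close> and reaches 2/5 at
      \<open>t = 1\<close>, the tip of the lens.\<close>
    moreover have "16/5 * t / (5 + 3 * t) \<le> 2/5" if "0 \<le> t" "t \<le> 1" for t :: real
      using that by (simp add: field_simps)
    ultimately show ?thesis by simp
  qed
  have equator: "(4/5 * \<sigma>) *\<^sub>R axis (Some undefined) 1 \<in> lens ` (usphere :: (real^('n option)) set)"
    if "\<sigma> = 1 \<or> \<sigma> = - 1" for \<sigma> :: real
  proof (rule image_eqI)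
    show "\<sigma> *\<^sub>R axis (Some undefined) 1 \<in> (usphere :: (real^('n option)) set)" using that by auto
    show "(4/5 * \<sigma>) *\<^sub>R axis (Some undefined) 1 = lens (\<sigma> *\<^sub>R axis (Some undefined) 1)"
      by (auto simp: lens_def vec_eq_iff axis_def split: option.split)
  qed
  have "lens ` topspace (top_of_set usphere) \<noteq> (\<lambda>x. a *\<^sub>R x + b) ` wulff_shape lens_integrand"
    if "a > 0" for a and b :: "real^('n option)"
    using lens_not_homothetic_wulff[OF height equator that] by simp
  moreover have "lens_integrand \<nu> > 0" if "\<nu> \<in> sphere 0 1" for \<nu> :: "real^('n option)"
    using lens_integrand_ge[of \<nu>] that by simp
  ultimately show ?thesis
    using smooth_lens_integrand not_convex_lens_integrand closed_embedded_CAMC_lens by blast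
qed

end
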